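(* For every $u\in M\cap\sigma^\vee$ there is a natural exact sequence $$0\to\widetilde I(L)_u\to A(C)_u\to A(L)_u\to0,$$ where the map $A(C)_u\to A(L)_u$ is induced by restriction to $L$, $z^v\chi^u\mapsto z^v|_L\cdot\chi^u$, and $(\cdot)_u$ denotes the $M$-degree $u$ part. Hence there is an embedding of $X(L)$ in $X(C)$ with ideal $\widetilde I(L)$.
   Context: $\mathbb{K}$ is an algebraically closed field; $T$ is an algebraic torus with character lattice $M$ and cocharacter lattice $N$. Fix $m\ge1$, a pointed polyhedral cone $\sigma\subset N_\mathbb{Q}$, and $\Delta_0,\dots,\Delta_m$, each either empty or a polyhedron in $N_\mathbb{Q}$ with tailcone $\{v:\Delta_i+v\subseteq\Delta_i\}=\sigma$, with $\sum_i\Delta_i\subsetneq\sigma$. For $u\in\sigma^\vee$, $\Delta_i(u)=\min_{v\in\Delta_i}\langle v,u\rangle$, and $\Delta_i(u)=\infty$ if $\Delta_i=\emptyset$ (a coefficient $\infty$ in a divisor allows poles of arbitrary order). Let $e_1,\dots,e_m$ be the standard basis of $\mathbb{Q}^m$, $e_0=-\sum_{i\ge1}e_i$, and let $C\subset N_\mathbb{Q}\times\mathbb{Q}^m$ be the cone generated by $\sigma\times0$ and all $\Delta_i\times e_i$, $0\le i\le m$. Put $A(C)=\mathbb{K}[C^\vee\cap(M\times\mathbb{Z}^m)]=\bigoplus_{(u,v)\in C^\vee\cap(M\times\mathbb{Z}^m)}\mathbb{K}\cdot\chi^{(u,v)}$ and $X(C)=\mathrm{Spec}\,A(C)$. Let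 $L\subset\mathbb{P}^m=\mathrm{Proj}\,\mathbb{K}[y_0,\dots,y_m]$ be any line meeting the dense torus $(\mathbb{K}^* )^m$, $z_i=y_i/y_0$ (so $\mathbb{K}[\mathbb{Z}^m]=\mathbb{K}[z_1^{\pm1},\dots,z_m^{\pm1}]$ and $\chi^{(u,v)}=z^v\chi^u$), $Q_i$ the restriction to $L$ of $V(y_i)$, and $$A(L)=\bigoplus_{u\in\sigma^\vee\cap M}H^0\Big(L,\mathcal{O}\big(\textstyle\sum_i\lfloor\Delta_i(u)\rfloor Q_i\big)\Big)\cdot\chi^u,\qquad X(L)=\mathrm{Spec}\,A(L).$$ Let $I(L)\subset\mathbb{K}[z_1^{\pm1},\dots,z_m^{\pm1}]$ be the ideal of $L^\circ=L\cap(\mathbb{K}^* )^m$, and let $\widetilde I(L)\subset A(C)$ be the ideal generated by all $f\cdot\chi^u$ with $u\in M$, $f\in I(L)$ and $f\cdot\chi^u\in A(C)$. $A(C)$ is $M$-graded via $\chi^{(u,v)}\mapsto u$. *)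

theory Defs
  imports
    "HOL-Library.Function_Algebras"
    "HOL-Library.Product_Plus"
    "HOL-Library.Poly_Mapping"
    "HOL-Library.Extended"
    "HOL-Library.FuncSet"
    "HOL-Computational_Algebra.Polynomial"
    "HOL-Computational_Algebra.Fraction_Field"
    "HOL-Algebra.RingHom"
    "HOL-Analysis.Finite_Cartesian_Product"
    "HOL-Analysis.Abstract_Topology"
begin

section \<open>Lattices, polyhedra and cones over the rationals\<close>

text \<open>
  The character lattice \<open>M\<close> is a type \<open>'u\<close> which is free abelian of finite rank (rank 0
  included).  The cocharacter space \<open>N\<^sub>\<rat> = Hom(M, \<rat>)\<close> consists of the additive maps \<open>'u \<Rightarrow> rat\<close>,
  and the pairing \<open>\<langle>v,u\<rangle>\<close> is the application \<open>v u\<close>.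
\<close>

definition free_of_finite_rank :: "'u::ab_group_add itself \<Rightarrow> bool" where
  "free_of_finite_rank _ \<longleftrightarrow>
     (\<exists>(n::nat) (\<phi> :: 'u \<Rightarrow> nat \<Rightarrow> int).
        Modules.additive \<phi> \<and> bij_betw \<phi> UNIV {w. \<forall>i\<ge>n. w i = 0})"

definition cochar_space :: "('u::ab_group_add \<Rightarrow> rat) set" where
  "cochar_space = {v. Modules.additive v}"

text \<open>
  Finite intersections of affine half-spaces \<open>\<langle>v,u\<rangle> \<ge> c\<close>.  Every half-space of \<open>N\<^sub>\<rat>\<close> has this
  form with \<open>u \<in> M\<close>, since a normal vector in \<open>M \<otimes> \<rat>\<close> can be scaled into \<open>M\<close>.
\<close>

definition rat_polyhedron :: "('u::ab_group_add \<Rightarrow> rat) set \<Rightarrow> bool" where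
  "rat_polyhedron P \<longleftrightarrow>
     (\<exists>H. finite H \<and> P = {v \<in> cochar_space. \<forall>(u, c) \<in> H. c \<le> v u})"

definition polyhedral_cone :: "('u::ab_group_add \<Rightarrow> rat) set \<Rightarrow> bool" where
  "polyhedral_cone \<sigma> \<longleftrightarrow>
     (\<exists>U. finite U \<and> \<sigma> = {v \<in> cochar_space. \<forall>u \<in> U. 0 \<le> v u})"

definition pointed :: "('u::ab_group_add \<Rightarrow> rat) set \<Rightarrow> bool" where
  "pointed \<sigma> \<longleftrightarrow> (\<forall>v. v \<in> \<sigma> \<and> - v \<in> \<sigma> \<longrightarrow> v = 0)"

definition tailcone :: "('u::ab_group_add \<Rightarrow> rat) set \<Rightarrow> ('u \<Rightarrow> rat) set" where
  "tailcone P = {v \<in> cochar_space. \<forall>x \<in> P. x + v \<in> P}"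

definition minkowski_sum :: "('i::finite \<Rightarrow> ('u \<Rightarrow> rat) set) \<Rightarrow> ('u \<Rightarrow> rat) set" where
  "minkowski_sum \<Delta> = {\<Sum>i\<in>UNIV. x i |x. \<forall>i. x i \<in> \<Delta> i}"

definition dual_cone :: "('u \<Rightarrow> rat) set \<Rightarrow> 'u set" where
  "dual_cone \<sigma> = {u. \<forall>v \<in> \<sigma>. 0 \<le> v u}"

definition eval_min :: "('u \<Rightarrow> rat) set \<Rightarrow> 'u \<Rightarrow> rat extended" where
  "eval_min P u = (if P = {} then \<infinity> else Fin (LEAST r. \<exists>v \<in> P. r = v u))"


section \<open>The cone \<open>C\<close> and its semigroup algebra\<close>

text \<open>
  The index set \<open>{0, \<dots>, m}\<close> is \<open>'m option\<close> with \<open>None\<close> in the role of \<open>0\<close>, for a finite type \<open>'m\<close>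
  with \<open>m \<ge> 1\<close> elements.
\<close>

definition e_vec :: "'m::finite option \<Rightarrow> rat ^ 'm" where
  "e_vec i = (case i of None \<Rightarrow> - (\<Sum>j\<in>UNIV. axis j 1) | Some j \<Rightarrow> axis j 1)"

definition is_convex_cone :: "(('u \<Rightarrow> rat) \<times> (rat ^ 'm::finite)) set \<Rightarrow> bool" where
  "is_convex_cone K \<longleftrightarrow> 0 \<in> K \<and> (\<forall>x \<in> K. \<forall>y \<in> K. x + y \<in> K) \<and>
     (\<forall>c\<ge>0. \<forall>(v, w) \<in> K. ((\<lambda>u. c * v u), c *s w) \<in> K)"

definition cone_C ::
  "('u \<Rightarrow> rat) set \<Rightarrow> ('m::finite option \<Rightarrow> ('u \<Rightarrow> rat) set) \<Rightarrow> (('u \<Rightarrow> rat) \<times> (rat ^ 'm)) set"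
  where "cone_C \<sigma> \<Delta> = is_convex_cone hull (\<sigma> \<times> {0} \<union> (\<Union>i. \<Delta> i \<times> {e_vec i}))"

definition dual_C :: "(('u \<Rightarrow> rat) \<times> (rat ^ 'm::finite)) set \<Rightarrow> ('u \<times> (int ^ 'm)) set" where
  "dual_C C = {(u, v). \<forall>(a, b) \<in> C. 0 \<le> a u + (\<Sum>j\<in>UNIV. b $ j * of_int (v $ j))}"

text \<open>
  The group algebra of an abelian group \<open>G\<close> over \<open>K\<close> is the type \<open>G \<Rightarrow>\<^sub>0 K\<close> with convolution as
  product; \<open>c \<cdot> \<chi>\<^sup>g\<close> is \<open>Poly_Mapping.single g c\<close>.
\<close>

definition ring_on :: "'a::comm_ring_1 set \<Rightarrow> 'a ring" where
  "ring_on S = \<lparr>carrier = S, mult = (*), one = 1, zero = 0, add = (+)\<rparr>"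

definition A_C ::
  "('u::ab_group_add \<Rightarrow> rat) set \<Rightarrow> ('m::finite option \<Rightarrow> ('u \<Rightarrow> rat) set)
     \<Rightarrow> ('u \<times> (int ^ 'm) \<Rightarrow>\<^sub>0 'k::field) set" where
  "A_C \<sigma> \<Delta> = {f. Poly_Mapping.keys f \<subseteq> dual_C (cone_C \<sigma> \<Delta>)}"

definition degree_part_C :: "'u \<Rightarrow> ('u \<times> 'v \<Rightarrow>\<^sub>0 'k::zero) set" where
  "degree_part_C u = {f. fst ` Poly_Mapping.keys f \<subseteq> {u}}"


section \<open>Lines in projective space and their rational functions\<close>

text \<open>
  A line \<open>L \<subset> \<pp>\<^sup>m\<close> is given by two linearly independent vectors \<open>p\<close>, \<open>q\<close> of homogeneous
  coordinates; it is the image of the linear embedding \<open>\<pp>\<^sup>1 \<rightarrow> \<pp>\<^sup>m\<close> sending \<open>x\<close> to \<open>[p + x q]\<close> and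
  \<open>\<infinity>\<close> to \<open>[q]\<close>.  This embedding identifies the function field of \<open>L\<close> with \<open>K(x)\<close>.
\<close>

datatype 'k proj_line = Affine 'k | At_Infinity

definition line_point ::
  "'k::field ^ 'i \<Rightarrow> 'k ^ 'i \<Rightarrow> 'k proj_line \<Rightarrow> 'k ^ 'i" where
  "line_point p q P = (case P of Affine x \<Rightarrow> p + x *s q | At_Infinity \<Rightarrow> q)"

definition lin_indep :: "'k::field ^ 'i \<Rightarrow> 'k ^ 'i \<Rightarrow> bool" where
  "lin_indep p q \<longleftrightarrow> (\<forall>s t. s *s p + t *s q = 0 \<longrightarrow> s = 0 \<and> t = 0)"

text \<open>The points of \<open>L\<close> in the dense torus, in the coordinates \<open>z\<^sub>i = y\<^sub>i / y\<^sub>0\<close>.\<close>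

definition line_torus ::
  "'k::field ^ ('m::finite option) \<Rightarrow> 'k ^ ('m option) \<Rightarrow> ('k ^ 'm) set" where
  "line_torus p q = {\<chi> j. y $ Some j / y $ None |y. (\<exists>P. y = line_point p q P) \<and> (\<forall>i. y $ i \<noteq> 0)}"

definition eval_Laurent :: "((int ^ 'm::finite) \<Rightarrow>\<^sub>0 'k::field) \<Rightarrow> 'k ^ 'm \<Rightarrow> 'k" where
  "eval_Laurent f x =
     (\<Sum>v\<in>Poly_Mapping.keys f. Poly_Mapping.lookup f v * (\<Prod>j\<in>UNIV. (x $ j) powi (v $ j)))"

definition ideal_line ::
  "'k::field ^ ('m::finite option) \<Rightarrow> 'k ^ ('m option) \<Rightarrow> ((int ^ 'm) \<Rightarrow>\<^sub>0 'k) set" where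
  "ideal_line p q = {f. \<forall>x \<in> line_torus p q. eval_Laurent f x = 0}"

definition times_chi :: "('v \<Rightarrow>\<^sub>0 'k::comm_monoid_add) \<Rightarrow> 'u \<Rightarrow> ('u \<times> 'v \<Rightarrow>\<^sub>0 'k)" where
  "times_chi f u =
     (\<Sum>v\<in>Poly_Mapping.keys f. Poly_Mapping.single (u, v) (Poly_Mapping.lookup f v))"

definition ideal_tilde ::
  "('u::ab_group_add \<Rightarrow> rat) set \<Rightarrow> ('m::finite option \<Rightarrow> ('u \<Rightarrow> rat) set)
     \<Rightarrow> 'k::field ^ ('m option) \<Rightarrow> 'k ^ ('m option) \<Rightarrow> ('u \<times> (int ^ 'm) \<Rightarrow>\<^sub>0 'k) set" where
  "ideal_tilde \<sigma> \<Delta> p q =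
     genideal (ring_on (A_C \<sigma> \<Delta>))
       {times_chi f u |f u. f \<in> ideal_line p q \<and> times_chi f u \<in> A_C \<sigma> \<Delta>}"

text \<open>The point \<open>Q\<^sub>i\<close>: a linear form not vanishing identically on a line has exactly one zero, of
  multiplicity one.\<close>

definition Q_point ::
  "'k::field ^ 'i \<Rightarrow> 'k ^ 'i \<Rightarrow> 'i \<Rightarrow> 'k proj_line" where
  "Q_point p q i = (THE P. line_point p q P $ i = 0)"

definition ord_poly :: "'k::field proj_line \<Rightarrow> 'k poly \<Rightarrow> int" where
  "ord_poly P g =
     (case P of Affine a \<Rightarrow> int (Polynomial.order a g) | At_Infinity \<Rightarrow> - int (Polynomial.degree g))"

definition ord_at :: "'k::field proj_line \<Rightarrow> 'k poly fract \<Rightarrow> int" where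
  "ord_at P f = (THE n. \<exists>g h. g \<noteq> 0 \<and> h \<noteq> 0 \<and> f = Fract g h \<and> n = ord_poly P g - ord_poly P h)"

lemma ord_poly_mult:
  assumes "g \<noteq> 0" "h \<noteq> 0"
  shows "ord_poly P (g * h) = ord_poly P g + ord_poly P h"
  using assms by (cases P) (simp_all add: ord_poly_def order_mult degree_mult_eq)

lemma ord_at_Fract:
  assumes "g \<noteq> 0" "h \<noteq> 0"
  shows "ord_at P (Fract g h) = ord_poly P g - ord_poly P h"
  unfolding ord_at_def
proof (rule the_equality)
  show "\<exists>g' h'. g' \<noteq> 0 \<and> h' \<noteq> 0 \<and> Fract g h = Fract g' h' \<and>
      ord_poly P g - ord_poly P h = ord_poly P g' - ord_poly P h'"
    using assms by blast
next
  fix n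
  assume "\<exists>g' h'. g' \<noteq> 0 \<and> h' \<noteq> 0 \<and> Fract g h = Fract g' h' \<and> n = ord_poly P g' - ord_poly P h'"
  then obtain g' h' where *: "g' \<noteq> 0" "h' \<noteq> 0" "Fract g h = Fract g' h'"
      "n = ord_poly P g' - ord_poly P h'"
    by blast
  then have "g * h' = g' * h"
    using assms by (simp add: eq_fract)
  then have "ord_poly P g + ord_poly P h' = ord_poly P g' + ord_poly P h"
    using assms * by (metis ord_poly_mult)
  then show "n = ord_poly P g - ord_poly P h"
    using * by simp
qed

text \<open>\<open>H\<^sup>0(\<pp>\<^sup>1, \<O>(D))\<close>, where coefficients of \<open>D\<close> may be \<open>\<infinity>\<close>.\<close>

definition global_sections ::
  "('k::field proj_line \<Rightarrow> int extended) \<Rightarrow> 'k poly fract set" where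
  "global_sections D = {f. f = 0 \<or> (\<forall>P. 0 \<le> Fin (ord_at P f) + D P)}"

definition divisor_L ::
  "('m::finite option \<Rightarrow> ('u \<Rightarrow> rat) set) \<Rightarrow> 'k::field ^ ('m option) \<Rightarrow> 'k ^ ('m option)
     \<Rightarrow> 'u \<Rightarrow> 'k proj_line \<Rightarrow> int extended" where
  "divisor_L \<Delta> p q u P = (\<Sum>i | Q_point p q i = P. map_extended floor (eval_min (\<Delta> i) u))"

text \<open>\<open>A(L)\<close> as a subring of the group algebra \<open>K(x)[M]\<close>.\<close>

definition A_L ::
  "('u::ab_group_add \<Rightarrow> rat) set \<Rightarrow> ('m::finite option \<Rightarrow> ('u \<Rightarrow> rat) set)
     \<Rightarrow> 'k::field ^ ('m option) \<Rightarrow> 'k ^ ('m option) \<Rightarrow> ('u \<Rightarrow>\<^sub>0 'k poly fract) set" where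
  "A_L \<sigma> \<Delta> p q =
     {f. Poly_Mapping.keys f \<subseteq> dual_cone \<sigma> \<and>
         (\<forall>u \<in> Poly_Mapping.keys f. Poly_Mapping.lookup f u \<in> global_sections (divisor_L \<Delta> p q u))}"

definition degree_part_L :: "'u \<Rightarrow> ('u \<Rightarrow>\<^sub>0 'a::zero) set" where
  "degree_part_L u = {f. Poly_Mapping.keys f \<subseteq> {u}}"


section \<open>The restriction map\<close>

definition const_fract :: "'k::field \<Rightarrow> 'k poly fract" where
  "const_fract c = Fract [:c:] 1"

definition z_restr ::
  "'k::field ^ ('m::finite option) \<Rightarrow> 'k ^ ('m option) \<Rightarrow> 'm \<Rightarrow> 'k poly fract" where
  "z_restr p q j = Fract [:p $ Some j, q $ Some j:] [:p $ None, q $ None:]"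

definition restr ::
  "'k::field ^ ('m::finite option) \<Rightarrow> 'k ^ ('m option)
     \<Rightarrow> ('u \<times> (int ^ 'm) \<Rightarrow>\<^sub>0 'k) \<Rightarrow> ('u \<Rightarrow>\<^sub>0 'k poly fract)" where
  "restr p q f =
     (\<Sum>(u, v)\<in>Poly_Mapping.keys f.
        Poly_Mapping.single u
          (const_fract (Poly_Mapping.lookup f (u, v)) * (\<Prod>j\<in>UNIV. z_restr p q j powi (v $ j))))"

definition scale_C :: "'k::field \<Rightarrow> ('a \<Rightarrow>\<^sub>0 'k) \<Rightarrow> ('a \<Rightarrow>\<^sub>0 'k)" where
  "scale_C c = Poly_Mapping.map ((*) c)"

definition scale_L :: "'k::field \<Rightarrow> ('a \<Rightarrow>\<^sub>0 'k poly fract) \<Rightarrow> ('a \<Rightarrow>\<^sub>0 'k poly fract)" where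
  "scale_L c = Poly_Mapping.map ((*) (const_fract c))"

definition linear_between ::
  "('k \<Rightarrow> 'a \<Rightarrow> 'a::ab_group_add) \<Rightarrow> ('k \<Rightarrow> 'b \<Rightarrow> 'b::ab_group_add)
     \<Rightarrow> 'a set \<Rightarrow> 'b set \<Rightarrow> ('a \<Rightarrow> 'b) \<Rightarrow> bool" where
  "linear_between s t A B f \<longleftrightarrow> f \<in> A \<rightarrow> B \<and>
     (\<forall>x \<in> A. \<forall>y \<in> A. f (x + y) = f x + f y) \<and> (\<forall>c. \<forall>x \<in> A. f (s c x) = t c (f x))"

text \<open>
  Exactness of \<open>0 \<rightarrow> A \<rightarrow> B \<rightarrow> C \<rightarrow> 0\<close> with maps \<open>f\<close>, \<open>g\<close>, where \<open>A\<close>, \<open>B\<close>, \<open>C\<close> are subspaces of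
  vector spaces with scalar multiplications \<open>r\<close>, \<open>s\<close>, \<open>t\<close>.
\<close>

definition short_exact ::
  "('k::field \<Rightarrow> 'a \<Rightarrow> 'a::ab_group_add) \<Rightarrow> ('k \<Rightarrow> 'b \<Rightarrow> 'b::ab_group_add)
     \<Rightarrow> ('k \<Rightarrow> 'c \<Rightarrow> 'c::ab_group_add)
     \<Rightarrow> 'a set \<Rightarrow> ('a \<Rightarrow> 'b) \<Rightarrow> 'b set \<Rightarrow> ('b \<Rightarrow> 'c) \<Rightarrow> 'c set \<Rightarrow> bool" where
  "short_exact r s t A f B g C \<longleftrightarrow>
     vector_space r \<and> vector_space s \<and> vector_space t \<and>
     Modules.module.subspace r A \<and> Modules.module.subspace s B \<and> Modules.module.subspace t C \<and>
     linear_between r s A B f \<and> linear_between s t B C g \<and>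
     inj_on f A \<and> f ` A = {x \<in> B. g x = 0} \<and> g ` B = C"


section \<open>Affine schemes and closed embeddings\<close>

definition Spec :: "('a, 'b) ring_scheme \<Rightarrow> 'a set set" where
  "Spec R = {P. primeideal P R}"

definition zariski :: "('a, 'b) ring_scheme \<Rightarrow> 'a set topology" where
  "zariski R = topology (\<lambda>U. \<exists>S \<subseteq> carrier R. U = {P \<in> Spec R. \<not> S \<subseteq> P})"

lemma openin_zariski:
  "openin (zariski R) U \<longleftrightarrow> (\<exists>S \<subseteq> carrier R. U = {P \<in> Spec R. \<not> S \<subseteq> P})"
proof -
  have "istopology (\<lambda>U. \<exists>S \<subseteq> carrier R. U = {P \<in> Spec R. \<not> S \<subseteq> P})"
    unfolding istopology_def
  proof (intro conjI allI impI)
    fix U V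
    assume "\<exists>S \<subseteq> carrier R. U = {P \<in> Spec R. \<not> S \<subseteq> P}"
      and "\<exists>S \<subseteq> carrier R. V = {P \<in> Spec R. \<not> S \<subseteq> P}"
    then obtain S T where S: "S \<subseteq> carrier R" "U = {P \<in> Spec R. \<not> S \<subseteq> P}"
      and T: "T \<subseteq> carrier R" "V = {P \<in> Spec R. \<not> T \<subseteq> P}"
      by blast
    define W where "W = {a \<otimes>\<^bsub>R\<^esub> b |a b. a \<in> S \<and> b \<in> T}"
    have iff: "W \<subseteq> P \<longleftrightarrow> S \<subseteq> P \<or> T \<subseteq> P" if "P \<in> Spec R" for P
    proof -
      interpret primeideal P R using that by (simp add: Spec_def)
      show ?thesis
      proof
        assume W: "W \<subseteq> P"
        show "S \<subseteq> P \<or> T \<subseteq> P"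
        proof (rule ccontr)
          assume "\<not> (S \<subseteq> P \<or> T \<subseteq> P)"
          then obtain a b where ab: "a \<in> S" "a \<notin> P" "b \<in> T" "b \<notin> P"
            by auto
          then have "a \<otimes>\<^bsub>R\<^esub> b \<in> P" using W by (auto simp: W_def)
          then show False using I_prime[of a b] ab S(1) T(1) by auto
        qed
      next
        assume "S \<subseteq> P \<or> T \<subseteq> P"
        then show "W \<subseteq> P"
          using S(1) T(1) by (auto simp: W_def intro: I_l_closed I_r_closed)
      qed
    qed
    show "\<exists>S \<subseteq> carrier R. U \<inter> V = {P \<in> Spec R. \<not> S \<subseteq> P}"
    proof (cases "Spec R = {}")
      case True
      then show ?thesis using S T by blast
    next
      case False
      then obtain P where "primeideal P R" by (auto simp: Spec_def)
      then interpret primeideal P R .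
      have "W \<subseteq> carrier R" using S(1) T(1) by (auto simp: W_def)
      moreover have "U \<inter> V = {P \<in> Spec R. \<not> W \<subseteq> P}" using S(2) T(2) iff by auto
      ultimately show ?thesis by blast
    qed
  next
    fix \<U>
    assume "\<forall>U\<in>\<U>. \<exists>S \<subseteq> carrier R. U = {P \<in> Spec R. \<not> S \<subseteq> P}"
    then obtain F where F: "\<And>U. U \<in> \<U> \<Longrightarrow> F U \<subseteq> carrier R"
        "\<And>U. U \<in> \<U> \<Longrightarrow> U = {P \<in> Spec R. \<not> F U \<subseteq> P}"
      by metis
    have "\<Union>\<U> = (\<Union>U\<in>\<U>. {P \<in> Spec R. \<not> F U \<subseteq> P})"
      using F(2) by auto
    also have "\<dots> = {P \<in> Spec R. \<not> \<Union>(F ` \<U>) \<subseteq> P}"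
      by auto
    finally show "\<exists>S \<subseteq> carrier R. \<Union>\<U> = {P \<in> Spec R. \<not> S \<subseteq> P}"
      using F(1) by (intro exI[of _ "\<Union>(F ` \<U>)"]) auto
  qed
  then show ?thesis
    by (simp add: zariski_def topology_inverse')
qed

text \<open>The fraction \<open>a/s\<close> in the localization \<open>R\<^sub>P\<close>, as a set of representing pairs.\<close>

definition loc_frac :: "('a, 'b) ring_scheme \<Rightarrow> 'a set \<Rightarrow> 'a \<Rightarrow> 'a \<Rightarrow> ('a \<times> 'a) set" where
  "loc_frac R P a s =
     {(b, t). b \<in> carrier R \<and> t \<in> carrier R - P \<and>
        (\<exists>w \<in> carrier R - P. w \<otimes>\<^bsub>R\<^esub> (t \<otimes>\<^bsub>R\<^esub> a) = w \<otimes>\<^bsub>R\<^esub> (s \<otimes>\<^bsub>R\<^esub> b))}"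

text \<open>
  Sections over \<open>U\<close> of the sheaf attached to an ideal \<open>J\<close>: families of elements of the
  localizations that are locally fractions with numerator in \<open>J\<close>.  For \<open>J = R\<close> this is the structure
  sheaf.
\<close>

definition ideal_sheaf ::
  "('a, 'b) ring_scheme \<Rightarrow> 'a set \<Rightarrow> 'a set set \<Rightarrow> ('a set \<Rightarrow> ('a \<times> 'a) set) set" where
  "ideal_sheaf R J U =
     {s \<in> extensional U. \<forall>P \<in> U. \<exists>V. openin (zariski R) V \<and> P \<in> V \<and> V \<subseteq> U \<and>
        (\<exists>a \<in> J. \<exists>h \<in> carrier R. \<forall>Q \<in> V. h \<notin> Q \<and> s Q = loc_frac R Q a h)}"

definition structure_sheaf ::
  "('a, 'b) ring_scheme \<Rightarrow> 'a set set \<Rightarrow> ('a set \<Rightarrow> ('a \<times> 'a) set) set" where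
  "structure_sheaf R U = ideal_sheaf R (carrier R) U"

definition zero_section :: "('a, 'b) ring_scheme \<Rightarrow> 'a set set \<Rightarrow> 'a set \<Rightarrow> ('a \<times> 'a) set" where
  "zero_section R U = restrict (\<lambda>P. loc_frac R P \<zero>\<^bsub>R\<^esub> \<one>\<^bsub>R\<^esub>) U"

definition Spec_map :: "('a, 'b) ring_scheme \<Rightarrow> ('a \<Rightarrow> 'c) \<Rightarrow> 'c set \<Rightarrow> 'a set" where
  "Spec_map R \<phi> Q = {a \<in> carrier R. \<phi> a \<in> Q}"

definition Spec_preimage ::
  "('a, 'b) ring_scheme \<Rightarrow> ('c, 'd) ring_scheme \<Rightarrow> ('a \<Rightarrow> 'c) \<Rightarrow> 'a set set \<Rightarrow> 'c set set" where
  "Spec_preimage R S \<phi> U = {Q \<in> Spec S. Spec_map R \<phi> Q \<in> U}"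

text \<open>
  The map of sections \<open>\<O>(U) \<rightarrow> \<O>(f\<^sup>-\<^sup>1 U)\<close> belonging to the morphism \<open>f = Spec \<phi>\<close>.  On stalks it is
  \<open>a/t \<mapsto> \<phi> a / \<phi> t\<close>; the union ranges over all representatives of one fraction and hence is a union
  of equal sets.
\<close>

definition Spec_sheaf_map ::
  "('a, 'b) ring_scheme \<Rightarrow> ('c, 'd) ring_scheme \<Rightarrow> ('a \<Rightarrow> 'c) \<Rightarrow> 'a set set
     \<Rightarrow> ('a set \<Rightarrow> ('a \<times> 'a) set) \<Rightarrow> ('c set \<Rightarrow> ('c \<times> 'c) set)" where
  "Spec_sheaf_map R S \<phi> U s =
     restrict (\<lambda>Q. \<Union>(a, t) \<in> s (Spec_map R \<phi> Q). loc_frac S Q (\<phi> a) (\<phi> t)) (Spec_preimage R S \<phi> U)"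

text \<open>
  \<open>Spec \<phi> : Spec S \<rightarrow> Spec R\<close> is a closed embedding with ideal (sheaf) \<open>J\<close>: it is a homeomorphism
  onto a closed subset, the map \<open>\<O> \<rightarrow> f\<^sub>* \<O>\<close> is a surjective map of sheaves, and the kernel of the
  latter is the sheaf attached to \<open>J\<close>.
\<close>

definition closed_embedding_with_ideal ::
  "('a, 'b) ring_scheme \<Rightarrow> ('c, 'd) ring_scheme \<Rightarrow> ('a \<Rightarrow> 'c) \<Rightarrow> 'a set \<Rightarrow> bool" where
  "closed_embedding_with_ideal R S \<phi> J \<longleftrightarrow>
     ring_hom_cring R S \<phi> \<and> ideal J R \<and>
     embedding_map (zariski S) (zariski R) (Spec_map R \<phi>) \<and>
     closed_map (zariski S) (zariski R) (Spec_map R \<phi>) \<and>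
     (\<forall>U. openin (zariski R) U \<longrightarrow>
        (\<forall>t \<in> structure_sheaf S (Spec_preimage R S \<phi> U). \<forall>P \<in> U.
           \<exists>V. openin (zariski R) V \<and> P \<in> V \<and> V \<subseteq> U \<and>
             (\<exists>s \<in> structure_sheaf R V.
                Spec_sheaf_map R S \<phi> V s = restrict t (Spec_preimage R S \<phi> V)))) \<and>
     (\<forall>U. openin (zariski R) U \<longrightarrow>
        {s \<in> structure_sheaf R U.
           Spec_sheaf_map R S \<phi> U s = zero_section S (Spec_preimage R S \<phi> U)}
        = ideal_sheaf R J U)"

end

theory Submission
  imports Defs "HOL-Algebra.QuotRing"
begin

text \<open>
  Fix \<open>u \<in> \<sigma>\<^sup>\<or>\<close> and put \<open>d\<^sub>i = \<lfloor>\<Delta>\<^sub>i(u)\<rfloor>\<close>.  In homogeneous coordinates \<open>z\<^sup>v\<close> is the monomial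
  \<open>\<Prod>\<^sub>i y\<^sub>i\<^bsup>\<langle>e\<^sub>i, v\<rangle>\<^esup>\<close> of degree \<open>0\<close>.  Testing on the generators of \<open>C\<close> shows that \<open>(u, v) \<in> C\<^sup>\<or>\<close> means
  \<open>\<langle>e\<^sub>i, v\<rangle> \<ge> -\<Delta>\<^sub>i(u)\<close> for all \<open>i\<close>, and as \<open>\<langle>e\<^sub>i, v\<rangle>\<close> is an integer this is \<open>\<langle>e\<^sub>i, v\<rangle> \<ge> -d\<^sub>i\<close>
  (\<open>dual_C_iff\<close>, \<open>nonneg_on_polyhedron_iff\<close>; the latter needs that \<open>u\<close> attains its minimum on \<open>\<Delta>\<^sub>i\<close>).
  If all \<open>d\<^sub>i\<close> are finite with sum \<open>d\<close>, then \<open>A(C)\<^sub>u\<close> consists of the quotients of forms of degree \<open>d\<close>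
  in \<open>y\<^sub>0, \<dots>, y\<^sub>m\<close> by \<open>\<Prod>\<^sub>i y\<^sub>i\<^bsup>d\<^sub>i\<^esup>\<close>, and \<open>A(L)\<^sub>u\<close> of the quotients of forms of degree \<open>d\<close> on \<open>L\<close> by
  the restriction of the same product.  Linear forms on \<open>\<pp>\<^sup>m\<close> restrict onto those on \<open>L\<close>, hence so do
  forms of degree \<open>d\<close>, and the restriction map is surjective (\<open>lift_polynomial\<close>,
  \<open>lift_global_section\<close>).  An infinite \<open>d\<^sub>i\<close> may be replaced by a large integer, since a single section
  has poles of bounded order (\<open>finite_truncation\<close>).

  A Laurent polynomial restricts to \<open>0\<close> in the function field of \<open>L\<close> if and only if it vanishes at all
  points of \<open>L\<^sup>\<circ>\<close>, because \<open>L\<^sup>\<circ>\<close> is infinite (\<open>restr_Laurent_eq_0_iff\<close>).  The restriction map being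
  graded, its kernel is spanned by homogeneous elements, and these are exactly the generators of
  \<open>I~(L)\<close> (\<open>ideal_tilde_eq_kernel\<close>).  This gives the exact sequences.

  So \<open>A(C) \<rightarrow> A(L)\<close> is a surjective ring homomorphism with kernel \<open>I~(L)\<close>, and any surjective
  homomorphism of commutative rings induces a closed embedding of spectra whose ideal sheaf is the
  one of the kernel (\<open>closed_embedding_of_surjection\<close>).
\<close>

section \<open>Minima of linear functions on polyhedra\<close>

lemma cochar_space_closed:
  "v \<in> cochar_space \<Longrightarrow> w \<in> cochar_space \<Longrightarrow> v + w \<in> cochar_space"
  "v \<in> cochar_space \<Longrightarrow> w \<in> cochar_space \<Longrightarrow> v - w \<in> cochar_space"
  "v \<in> cochar_space \<Longrightarrow> (\<lambda>u. c * v u) \<in> cochar_space"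
  by (auto simp: cochar_space_def Modules.additive_def algebra_simps)

definition active :: "('u \<times> rat) set \<Rightarrow> ('u \<Rightarrow> rat) \<Rightarrow> ('u \<times> rat) set" where
  "active H x = {h \<in> H. x (fst h) = snd h}"

text \<open>
  Rigidity says that \<open>u\<close> is constant on the affine subspace cut out by the constraints active at \<open>x\<close>.
  Hence the value of \<open>u\<close> at a rigid point depends only on the set of active constraints.
\<close>

definition rigid :: "('u::ab_group_add \<times> rat) set \<Rightarrow> 'u \<Rightarrow> ('u \<Rightarrow> rat) \<Rightarrow> bool" where
  "rigid H u x \<longleftrightarrow> (\<forall>d \<in> cochar_space. (\<forall>h \<in> active H x. d (fst h) = 0) \<longrightarrow> d u = 0)"

lemma tailcone_contains_recession:
  assumes P: "P = {v \<in> cochar_space. \<forall>(u, c) \<in> H. c \<le> v u}"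
    and d: "d \<in> cochar_space" "\<forall>h \<in> H. 0 \<le> d (fst h)"
  shows "d \<in> tailcone P"
  using d unfolding tailcone_def P by (fastforce intro: cochar_space_closed add_increasing2)

text \<open>
  At a point that is not rigid, move in a direction \<open>d\<close> that keeps the active constraints active and
  decreases \<open>u\<close>.  A further constraint stops the motion: otherwise \<open>d\<close> would lie in the tailcone,
  where \<open>u\<close> is nonnegative.  The number of inactive constraints drops.
\<close>

lemma move_to_rigid:
  assumes P: "P = {v \<in> cochar_space. \<forall>(u, c) \<in> H. c \<le> v u}" and fin: "finite H"
    and u: "u \<in> dual_cone (tailcone P)"
  shows "x \<in> P \<Longrightarrow> \<exists>y \<in> P. rigid H u y \<and> y u \<le> x u"
proof (induction "card (H - active H x)" arbitrary: x rule: less_induct)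
  case less
  show ?case
  proof (cases "rigid H u x")
    case True
    then show ?thesis using less.prems by blast
  next
    case False
    then obtain d0 where d0: "d0 \<in> cochar_space" "\<forall>h \<in> active H x. d0 (fst h) = 0" "d0 u \<noteq> 0"
      by (auto simp: rigid_def)
    define d where "d = (\<lambda>a. (if d0 u > 0 then -1 else 1) * d0 a)"
    have "d \<in> cochar_space" unfolding d_def using d0(1) by (rule cochar_space_closed(3))
    moreover have "\<forall>h \<in> active H x. d (fst h) = 0" "d u < 0"
      using d0(2,3) by (auto simp: d_def)
    ultimately have d: "d \<in> cochar_space" "\<forall>h \<in> active H x. d (fst h) = 0" "d u < 0" by auto
    have "d \<notin> tailcone P" using u d(3) unfolding dual_cone_def by fastforce
    define B where "B = {h \<in> H. d (fst h) < 0}"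
    have B: "finite B" "B \<noteq> {}"
      using fin tailcone_contains_recession[OF P d(1)] \<open>d \<notin> tailcone P\<close> unfolding B_def by force+
    define f where "f h = (x (fst h) - snd h) / (- d (fst h))" for h
    \<comment> \<open>\<open>f h\<close> is the time at which the ray reaches the constraint \<open>h\<close>.\<close>
    define t where "t = Min (f ` B)"
    have "t \<in> f ` B" using Min_in[of "f ` B"] B by (simp add: t_def)
    then obtain h0 where h0: "h0 \<in> B" "f h0 = t" by blast
    have xH: "snd h \<le> x (fst h)" if "h \<in> H" for h
      using less.prems that unfolding P by auto
    have t0: "0 \<le> t"
    proof -
      have "0 \<le> x (fst h0) - snd h0" "0 < - d (fst h0)" using h0(1) xH by (auto simp: B_def)
      then have "0 \<le> f h0" unfolding f_def by (intro divide_nonneg_pos)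
      then show ?thesis by (simp add: h0(2))
    qed
    define y where "y = x + (\<lambda>a. t * d a)"
    have yH: "snd h \<le> y (fst h)" if h: "h \<in> H" for h
    proof (cases "h \<in> B")
      case True
      then have "t \<le> f h" using B by (simp add: t_def)
      moreover have "0 < - d (fst h)" using True by (simp add: B_def)
      ultimately have "t * (- d (fst h)) \<le> x (fst h) - snd h"
        by (simp only: f_def pos_le_divide_eq)
      then show ?thesis by (simp add: y_def)
    next
      case False
      then have "0 \<le> t * d (fst h)" using t0 h by (simp add: B_def)
      then show ?thesis using xH[OF h] by (simp add: y_def)
    qed
    have "x \<in> cochar_space" using less.prems P by auto
    then have "y \<in> cochar_space" unfolding y_def using d(1) by (intro cochar_space_closed)
    then have yP: "y \<in> P" using yH unfolding P by auto
    have sub: "active H x \<subseteq> active H y" using d(2) by (auto simp: active_def y_def)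
    have dh0: "h0 \<in> H" "d (fst h0) < 0" using h0 by (auto simp: B_def)
    have "t * (- d (fst h0)) = x (fst h0) - snd h0" using h0(2) dh0(2) by (auto simp: f_def)
    then have "h0 \<in> active H y" using dh0 by (simp add: active_def y_def)
    moreover have "h0 \<notin> active H x" using dh0 d(2) by force
    ultimately have "H - active H y \<subset> H - active H x" using sub dh0(1) by blast
    then have "card (H - active H y) < card (H - active H x)" using fin by (intro psubset_card_mono) auto
    from less.hyps[OF this yP] obtain z where z: "z \<in> P" "rigid H u z" "z u \<le> y u" by blast
    have "t * d u \<le> 0" using t0 d(3) by (simp add: mult_nonneg_nonpos)
    then have "y u \<le> x u" by (simp add: y_def)
    then show ?thesis using z by force
  qed
qed

text \<open>
  Every point lies above a rigid one, and there are only finitely many values at rigid points, one for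
  each set of active constraints.
\<close>

lemma polyhedron_attains_min:
  assumes "rat_polyhedron P" "P \<noteq> {}" and u: "u \<in> dual_cone (tailcone P)"
  shows "\<exists>v \<in> P. \<forall>w \<in> P. v u \<le> w u"
proof -
  obtain H where fin: "finite H" and P: "P = {v \<in> cochar_space. \<forall>(u, c) \<in> H. c \<le> v u}"
    using assms(1) unfolding rat_polyhedron_def by blast
  define R where "R = {x \<in> P. rigid H u x}"
  have same: "x u = y u" if "x \<in> R" "y \<in> R" "active H x = active H y" for x y
  proof -
    have "(x - y) u = 0"
    proof -
      have "x - y \<in> cochar_space" using that P by (auto simp: R_def intro: cochar_space_closed)
      moreover have "\<forall>h \<in> active H x. (x - y) (fst h) = 0"
      proof
        fix h assume "h \<in> active H x"
        moreover from this have "h \<in> active H y" using that(3) by simp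
        ultimately show "(x - y) (fst h) = 0" by (simp add: active_def)
      qed
      ultimately show ?thesis using that(1) unfolding R_def rigid_def by blast
    qed
    then show ?thesis by simp
  qed
  have "finite (active H ` R)"
    by (rule finite_subset[of _ "Pow H"]) (auto simp: active_def fin)
  moreover have "(\<lambda>x. x u) ` R \<subseteq> (\<lambda>A. (SOME x. x \<in> R \<and> active H x = A) u) ` active H ` R"
  proof safe
    fix x assume x: "x \<in> R"
    define y where "y = (SOME y. y \<in> R \<and> active H y = active H x)"
    have "y \<in> R \<and> active H y = active H x" unfolding y_def by (rule someI[of _ x]) (simp add: x)
    then have "x u = y u" using same x by metis
    then show "x u \<in> (\<lambda>A. (SOME x. x \<in> R \<and> active H x = A) u) ` active H ` R"
      using x unfolding y_def by blast
  qed
  ultimately have finR: "finite ((\<lambda>x. x u) ` R)"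
    using finite_imageI finite_subset by blast
  obtain x0 where "x0 \<in> P" using assms(2) by blast
  then have "R \<noteq> {}" using move_to_rigid[OF P fin u] by (auto simp: R_def)
  then have "Min ((\<lambda>x. x u) ` R) \<in> (\<lambda>x. x u) ` R" using finR by (intro Min_in) auto
  then obtain v where v: "v \<in> R" "v u = Min ((\<lambda>x. x u) ` R)" by force
  have "v u \<le> w u" if w: "w \<in> P" for w
  proof -
    obtain z where z: "z \<in> P" "rigid H u z" "z u \<le> w u" using move_to_rigid[OF P fin u w] by blast
    then have "z u \<in> (\<lambda>x. x u) ` R" by (auto simp: R_def)
    then have "v u \<le> z u" using v(2) finR by simp
    then show ?thesis using z(3) by simp
  qed
  then show ?thesis using v(1) by (auto simp: R_def)
qed

text \<open>
  This turns the inequalities defining \<open>C\<^sup>\<or>\<close> into inequalities between exponents and coefficients of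
  the divisor; an empty polyhedron gives no condition and the coefficient \<open>\<infinity>\<close>.
\<close>

lemma nonneg_on_polyhedron_iff:
  assumes P: "P = {} \<or> (rat_polyhedron P \<and> tailcone P = \<sigma>)" and u: "u \<in> dual_cone \<sigma>"
  shows "(\<forall>a \<in> P. 0 \<le> a u + of_int z) \<longleftrightarrow> 0 \<le> map_extended floor (eval_min P u) + Fin z"
proof (cases "P = {}")
  case True
  then show ?thesis by (simp add: eval_min_def zero_extended_def)
next
  case False
  then have "rat_polyhedron P" "u \<in> dual_cone (tailcone P)" using P u by auto
  then obtain v where v: "v \<in> P" "\<forall>w \<in> P. v u \<le> w u" using polyhedron_attains_min False by blast
  have "(LEAST r. \<exists>v \<in> P. r = v u) = v u" by (rule Least_equality) (use v in auto)
  then have eq: "eval_min P u = Fin (v u)" using False by (simp add: eval_min_def)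
  have "(\<forall>a \<in> P. 0 \<le> a u + of_int z) \<longleftrightarrow> 0 \<le> v u + of_int z" using v by force
  also have "\<dots> \<longleftrightarrow> of_int (- z) \<le> v u" by auto
  also have "\<dots> \<longleftrightarrow> - z \<le> \<lfloor>v u\<rfloor>" by (simp only: le_floor_iff)
  finally show ?thesis by (simp add: eq zero_extended_def) linarith
qed

section \<open>The dual cone of \<open>C\<close>\<close>

text \<open>The integers \<open>\<langle>e\<^sub>i, v\<rangle>\<close> are the exponents of \<open>z\<^sup>v\<close> as a monomial of degree \<open>0\<close> in the homogeneous
  coordinates \<open>y\<^sub>0, \<dots>, y\<^sub>m\<close>.\<close>

definition homog_exp :: "int ^ 'm::finite \<Rightarrow> 'm option \<Rightarrow> int" where
  "homog_exp v i = (case i of None \<Rightarrow> - (\<Sum>j\<in>UNIV. v $ j) | Some j \<Rightarrow> v $ j)"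

lemma homog_exp_simps [simp]:
  "homog_exp v None = - (\<Sum>j\<in>UNIV. v $ j)" "homog_exp v (Some j) = v $ j"
  by (simp_all add: homog_exp_def)

lemma homog_exp_add: "homog_exp (v + w) i = homog_exp v i + homog_exp w i"
  by (cases i) (simp_all add: sum.distrib)

lemma sum_option: "(\<Sum>i\<in>UNIV. f i) = f None + (\<Sum>j\<in>UNIV. f (Some j))"
  for f :: "'m::finite option \<Rightarrow> 'a::comm_monoid_add"
  by (simp add: UNIV_option_conv sum.reindex)

lemma sum_homog_exp: "(\<Sum>i\<in>UNIV. homog_exp v i) = 0"
  by (simp add: sum_option)

lemma ex_homog_exp:
  assumes "(\<Sum>i\<in>UNIV. d i) = 0"
  shows "\<exists>v. homog_exp v = d"
proof (intro exI ext)
  fix i show "homog_exp (\<chi> j. d (Some j)) i = d i"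
    using assms by (cases i) (simp_all add: sum_option)
qed

lemma e_vec_pairing:
  "(\<Sum>j\<in>UNIV. e_vec i $ j * of_int (v $ j)) = (of_int (homog_exp v i) :: rat)"
proof (cases i)
  case None
  have "e_vec i $ j = -1" for j :: 'a
    by (simp add: None e_vec_def axis_def)
  then show ?thesis by (simp add: None sum_negf)
next
  case (Some k)
  have "e_vec i $ j * of_int (v $ j) = (if j = k then of_int (v $ j) else 0)" for j
    by (simp add: Some e_vec_def axis_def)
  then show ?thesis by (simp add: Some)
qed

text \<open>
  A linear inequality holds on a cone if it holds on its generators.
\<close>

lemma dual_C_iff:
  "(u, v) \<in> dual_C (cone_C \<sigma> \<Delta>) \<longleftrightarrow>
     u \<in> dual_cone \<sigma> \<and> (\<forall>i. \<forall>a \<in> \<Delta> i. 0 \<le> a u + of_int (homog_exp v i))"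
proof -
  define G where "G = \<sigma> \<times> {0} \<union> (\<Union>i. \<Delta> i \<times> {e_vec i})"
  define K where "K = {(a, b). 0 \<le> a u + (\<Sum>j\<in>UNIV. b $ j * (of_int (v $ j) :: rat))}"
  have "is_convex_cone K"
  proof -
    have "(\<Sum>j\<in>UNIV. c * b $ j * of_int (v $ j)) = c * (\<Sum>j\<in>UNIV. b $ j * of_int (v $ j))"
      for c :: rat and b :: "rat ^ 'b"
      by (simp add: sum_distrib_left mult.assoc)
    moreover have "(\<Sum>j\<in>UNIV. (b + b') $ j * of_int (v $ j))
        = (\<Sum>j\<in>UNIV. b $ j * of_int (v $ j)) + (\<Sum>j\<in>UNIV. b' $ j * of_int (v $ j))"
      for b b' :: "rat ^ 'b"
      by (simp add: distrib_right sum.distrib)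
    ultimately show ?thesis
      unfolding is_convex_cone_def K_def
      by (auto simp: zero_prod_def simp flip: distrib_left)
  qed
  then have "cone_C \<sigma> \<Delta> \<subseteq> K \<longleftrightarrow> G \<subseteq> K"
    unfolding cone_C_def G_def by (meson hull_minimal hull_subset order_trans)
  moreover have "(u, v) \<in> dual_C (cone_C \<sigma> \<Delta>) \<longleftrightarrow> cone_C \<sigma> \<Delta> \<subseteq> K"
    by (auto simp: dual_C_def K_def)
  moreover have "G \<subseteq> K \<longleftrightarrow> u \<in> dual_cone \<sigma> \<and> (\<forall>i. \<forall>a \<in> \<Delta> i. 0 \<le> a u + of_int (homog_exp v i))"
  proof -
    have "G \<subseteq> K \<longleftrightarrow> (\<forall>a \<in> \<sigma>. (a, 0) \<in> K) \<and> (\<forall>i. \<forall>a \<in> \<Delta> i. (a, e_vec i) \<in> K)"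
      unfolding G_def by auto
    then show ?thesis by (simp add: K_def dual_cone_def e_vec_pairing)
  qed
  ultimately show ?thesis by simp
qed

section \<open>Restriction of Laurent polynomials to a line\<close>

lemma const_fract_0 [simp]: "const_fract 0 = 0"
  and const_fract_1 [simp]: "const_fract 1 = 1"
  and const_fract_add: "const_fract (c + d) = const_fract c + const_fract d"
  and const_fract_mult: "const_fract (c * d) = const_fract c * const_fract d"
  by (simp_all add: const_fract_def Zero_fract_def One_fract_def one_pCons mult.commute)

lemma prod_option: "(\<Prod>i\<in>UNIV. f i) = f None * (\<Prod>j\<in>UNIV. f (Some j))"
  for f :: "'m::finite option \<Rightarrow> 'a::comm_monoid_mult"
  by (simp add: UNIV_option_conv prod.reindex)

lemma power_int_sum:
  fixes x :: "'a::field"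
  assumes "x \<noteq> 0"
  shows "x powi (\<Sum>j\<in>A. f j) = (\<Prod>j\<in>A. x powi f j)"
  by (induction A rule: infinite_finite_induct) (simp_all add: power_int_add assms)

lemma poly_mapping_sum_singles:
  "f = (\<Sum>k\<in>Poly_Mapping.keys f. Poly_Mapping.single k (Poly_Mapping.lookup f k))"
proof (rule poly_mapping_eqI)
  fix k
  have "Poly_Mapping.lookup (\<Sum>k\<in>Poly_Mapping.keys f. Poly_Mapping.single k (Poly_Mapping.lookup f k)) k
      = (\<Sum>l\<in>Poly_Mapping.keys f. if l = k then Poly_Mapping.lookup f l else 0)"
    by (simp add: lookup_sum lookup_single when_def)
  then show "Poly_Mapping.lookup f k =
      Poly_Mapping.lookup (\<Sum>k\<in>Poly_Mapping.keys f. Poly_Mapping.single k (Poly_Mapping.lookup f k)) k"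
    by (simp add: in_keys_iff)
qed

section \<open>Homogeneous elements\<close>

text \<open>
  The Laurent polynomial \<open>g\<close> for which \<open>g \<cdot> \<chi>\<^sup>u\<close> is the component of degree \<open>u\<close>.
\<close>

abbreviation slice :: "'u \<Rightarrow> ('u \<times> 'v \<Rightarrow>\<^sub>0 'k::zero) \<Rightarrow> ('v \<Rightarrow>\<^sub>0 'k)" where
  "slice u \<equiv> Poly_Mapping.map_key (Pair u)"

lemma lookup_slice [simp]: "Poly_Mapping.lookup (slice u f) v = Poly_Mapping.lookup f (u, v)"
  by (simp add: map_key.rep_eq inj_def)

lemma lookup_times_chi:
  "Poly_Mapping.lookup (times_chi g u) k = (if fst k = u then Poly_Mapping.lookup g (snd k) else 0)"
proof -
  have "Poly_Mapping.lookup (times_chi g u) k =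
      (\<Sum>v\<in>Poly_Mapping.keys g. if v = snd k then if fst k = u then Poly_Mapping.lookup g v else 0 else 0)"
    unfolding times_chi_def lookup_sum lookup_single
    by (intro sum.cong refl, cases k) (auto simp: when_def)
  then show ?thesis by (simp add: in_keys_iff)
qed

lemma slice_times_chi: "slice u' (times_chi g u) = (if u' = u then g else 0)"
  by (rule poly_mapping_eqI) (simp add: lookup_times_chi)

lemma times_chi_slice:
  assumes "f \<in> degree_part_C u"
  shows "times_chi (slice u f) u = f"
proof (rule poly_mapping_eqI)
  fix k
  show "Poly_Mapping.lookup (times_chi (slice u f) u) k = Poly_Mapping.lookup f k"
    using assms by (cases k) (force simp: lookup_times_chi degree_part_C_def in_keys_iff)
qed

lemma keys_times_chi: "Poly_Mapping.keys (times_chi g u) = Pair u ` Poly_Mapping.keys g"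
proof -
  have "k \<in> Poly_Mapping.keys (times_chi g u) \<longleftrightarrow> k \<in> Pair u ` Poly_Mapping.keys g" for k
    by (cases k) (auto simp: in_keys_iff lookup_times_chi)
  then show ?thesis by blast
qed

lemma times_chi_degree: "times_chi g u \<in> degree_part_C u"
  by (auto simp: degree_part_C_def keys_times_chi)

lemma sum_times_chi_slice:
  "f = (\<Sum>u\<in>fst ` Poly_Mapping.keys f. times_chi (slice u f) u)"
proof (rule poly_mapping_eqI)
  fix k
  have "Poly_Mapping.lookup (\<Sum>u\<in>fst ` Poly_Mapping.keys f. times_chi (slice u f) u) k =
     (\<Sum>u\<in>fst ` Poly_Mapping.keys f. if u = fst k then Poly_Mapping.lookup f (u, snd k) else 0)"
    unfolding lookup_sum lookup_times_chi by (intro sum.cong) auto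
  also have "\<dots> = Poly_Mapping.lookup f k"
    by (auto simp: in_keys_iff image_iff)
  finally show "Poly_Mapping.lookup f k =
      Poly_Mapping.lookup (\<Sum>u\<in>fst ` Poly_Mapping.keys f. times_chi (slice u f) u) k" by simp
qed

section \<open>Linear forms and monomials on the line\<close>

locale torus_line =
  fixes p q :: "'k::alg_closed_field ^ ('m::finite option)"
  assumes indep: "lin_indep p q" and meets_torus: "line_torus p q \<noteq> {}"
begin

definition lform :: "'m option \<Rightarrow> 'k poly" where
  "lform i = [:p $ i, q $ i:]"

definition lfun :: "'m option \<Rightarrow> 'k poly fract" where
  "lfun i = Fract (lform i) 1"

text \<open>
  The restriction of \<open>\<Prod>\<^sub>i y\<^sub>i\<^bsup>d\<^sub>i\<^esup>\<close>, dehomogenized by the parameter \<open>x\<close> of the line.  If \<open>d\<close> has sum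
  \<open>0\<close>, the product is itself a rational function and the dehomogenization does not change it.
\<close>

definition lmon :: "('m option \<Rightarrow> int) \<Rightarrow> 'k poly fract" where
  "lmon d = (\<Prod>i\<in>UNIV. lfun i powi d i)"

definition zmon :: "int ^ 'm \<Rightarrow> 'k poly fract" where
  "zmon v = (\<Prod>j\<in>UNIV. z_restr p q j powi (v $ j))"

definition restr_Laurent :: "((int ^ 'm) \<Rightarrow>\<^sub>0 'k) \<Rightarrow> 'k poly fract" where
  "restr_Laurent g = (\<Sum>v\<in>Poly_Mapping.keys g. const_fract (Poly_Mapping.lookup g v) * zmon v)"

lemma lform_nonzero: "lform i \<noteq> 0"
proof -
  obtain P where P: "\<forall>i. line_point p q P $ i \<noteq> 0"
    using meets_torus unfolding line_torus_def by blast
  then have "line_point p q P $ i \<noteq> 0" by blast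
  then show ?thesis by (cases P) (auto simp: lform_def line_point_def)
qed

lemma lfun_nonzero: "lfun i \<noteq> 0"
  using lform_nonzero by (simp add: lfun_def Zero_fract_def eq_fract)

lemma z_restr_eq: "z_restr p q j = lfun (Some j) / lfun None"
  by (simp add: z_restr_def lfun_def lform_def)

lemma lmon_0: "lmon (\<lambda>i. 0) = 1"
  by (simp add: lmon_def)

lemma lmon_add: "lmon (\<lambda>i. d i + e i) = lmon d * lmon e"
  by (simp add: lmon_def power_int_add lfun_nonzero prod.distrib)

lemma lmon_nonzero: "lmon d \<noteq> 0"
  by (simp add: lmon_def lfun_nonzero)

lemma lmon_delta: "lmon (\<lambda>k. if k = i then 1 else 0) = lfun i"
proof -
  have "lfun k powi (if k = i then 1 else 0) = (if k = i then lfun k else 1)" for k by simp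
  then show ?thesis by (simp add: lmon_def)
qed

lemma zmon_eq_lmon: "zmon v = lmon (homog_exp v)"
proof -
  have "zmon v = (\<Prod>j\<in>UNIV. lfun (Some j) powi (v $ j) * inverse (lfun None) powi (v $ j))"
    by (simp add: zmon_def z_restr_eq divide_inverse power_int_mult_distrib)
  also have "\<dots> = (\<Prod>j\<in>UNIV. lfun (Some j) powi (v $ j)) * inverse (lfun None) powi (\<Sum>j\<in>UNIV. v $ j)"
    by (simp add: prod.distrib power_int_sum lfun_nonzero)
  also have "\<dots> = lmon (homog_exp v)"
    by (simp add: lmon_def prod_option power_int_minus power_int_inverse)
  finally show ?thesis .
qed

lemma zmon_add: "zmon (v + w) = zmon v * zmon w"
proof -
  have "homog_exp (v + w) = (\<lambda>i. homog_exp v i + homog_exp w i)"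
    by (rule ext) (rule homog_exp_add)
  then show ?thesis by (simp add: zmon_eq_lmon lmon_add)
qed

lemma zmon_0: "zmon 0 = 1"
  by (simp add: zmon_def)

section \<open>The restriction homomorphism\<close>

lemma restr_Laurent_superset:
  assumes "finite A" "Poly_Mapping.keys g \<subseteq> A"
  shows "restr_Laurent g = (\<Sum>v\<in>A. const_fract (Poly_Mapping.lookup g v) * zmon v)"
  unfolding restr_Laurent_def using assms
  by (intro sum.mono_neutral_left) (auto simp: in_keys_iff)

lemma restr_Laurent_0 [simp]: "restr_Laurent 0 = 0"
  by (simp add: restr_Laurent_def)

lemma restr_Laurent_add: "restr_Laurent (g + h) = restr_Laurent g + restr_Laurent h"
proof -
  let ?A = "Poly_Mapping.keys g \<union> Poly_Mapping.keys h"
  have "Poly_Mapping.keys (g + h) \<subseteq> ?A" by (rule Poly_Mapping.keys_add)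
  then show ?thesis
    by (simp add: restr_Laurent_superset[of ?A] lookup_add const_fract_add distrib_right sum.distrib)
qed

lemma restr_Laurent_single: "restr_Laurent (Poly_Mapping.single v c) = const_fract c * zmon v"
  by (subst restr_Laurent_superset[of "{v}"]) auto

lemma lookup_restr: "Poly_Mapping.lookup (restr p q f) u = restr_Laurent (slice u f)"
proof -
  define F where "F k = const_fract (Poly_Mapping.lookup f k) * zmon (snd k)" for k
  have "Poly_Mapping.lookup (restr p q f) u = (\<Sum>k\<in>Poly_Mapping.keys f. if fst k = u then F k else 0)"
    unfolding restr_def lookup_sum F_def zmon_def
    by (intro sum.cong refl) (auto simp: lookup_single when_def)
  also have "\<dots> = (\<Sum>k\<in>{k\<in>Poly_Mapping.keys f. fst k = u}. F k)"
    by (rule sum.inter_filter[symmetric]) simp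
  also have "{k\<in>Poly_Mapping.keys f. fst k = u} = Pair u ` Poly_Mapping.keys (slice u f)"
    by (force simp: in_keys_iff)
  also have "(\<Sum>k\<in>\<dots>. F k) = restr_Laurent (slice u f)"
    by (subst sum.reindex) (auto simp: inj_on_def F_def restr_Laurent_def)
  finally show ?thesis .
qed

lemma restr_times_chi: "restr p q (times_chi g u) = Poly_Mapping.single u (restr_Laurent g)"
  by (rule poly_mapping_eqI) (auto simp: lookup_restr slice_times_chi lookup_single when_def)

lemma restr_0 [simp]: "restr p q 0 = 0"
  by (simp add: restr_def)

lemma restr_add: "restr p q (f + g) = restr p q f + restr p q g"
proof (rule poly_mapping_eqI)
  fix u
  have "slice u (f + g) = slice u f + slice u g"
    by (rule poly_mapping_eqI) (simp add: lookup_add)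
  then show "Poly_Mapping.lookup (restr p q (f + g)) u = Poly_Mapping.lookup (restr p q f + restr p q g) u"
    by (simp add: lookup_restr lookup_add restr_Laurent_add)
qed

lemma restr_sum: "restr p q (\<Sum>i\<in>I. f i) = (\<Sum>i\<in>I. restr p q (f i))"
  by (induction I rule: infinite_finite_induct) (simp_all add: restr_add)

lemma restr_single:
  "restr p q (Poly_Mapping.single (u, v) c) = Poly_Mapping.single u (const_fract c * zmon v)"
  by (simp add: restr_def zmon_def)

lemma restr_const: "restr p q (Poly_Mapping.single 0 c) = Poly_Mapping.single 0 (const_fract c)"
  by (simp add: zero_prod_def restr_single zmon_0)

lemma restr_one: "restr p q 1 = 1"
  using restr_const[of 1] by simp

text \<open>
  Both sides are biadditive, so it is enough to compare them on multiples of characters.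
\<close>

lemma restr_mult: "restr p q (f * g) = restr p q f * restr p q g"
  for f g :: "'u::ab_group_add \<times> (int ^ 'm) \<Rightarrow>\<^sub>0 'k"
proof -
  let ?s = "\<lambda>f k. Poly_Mapping.single k (Poly_Mapping.lookup f k)"
  let ?K = Poly_Mapping.keys
  have single: "restr p q (Poly_Mapping.single k c * Poly_Mapping.single l d) =
      restr p q (Poly_Mapping.single k c) * restr p q (Poly_Mapping.single l d)"
    for k l :: "'u \<times> (int ^ 'm)" and c d :: 'k
    by (cases k, cases l) (simp add: mult_single restr_single zmon_add const_fract_mult mult_ac)
  have "restr p q (f * g) = restr p q ((\<Sum>k\<in>?K f. ?s f k) * (\<Sum>l\<in>?K g. ?s g l))"
    using poly_mapping_sum_singles[of f] poly_mapping_sum_singles[of g] by simp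
  also have "\<dots> = (\<Sum>k\<in>?K f. restr p q (?s f k)) * (\<Sum>l\<in>?K g. restr p q (?s g l))"
    by (simp add: sum_product restr_sum single)
  also have "\<dots> = restr p q f * restr p q g"
    using poly_mapping_sum_singles[of f] poly_mapping_sum_singles[of g] by (simp flip: restr_sum)
  finally show ?thesis .
qed

end

section \<open>Values of rational functions at points of the line\<close>

text \<open>
  A polynomial of degree at most \<open>N\<close> is a binary form of degree \<open>N\<close>; this is its value at the
  representative of \<open>P\<close> used by \<^const>\<open>line_point\<close>.  It makes the point at infinity, which may lie in
  the torus, as good as any other.
\<close>

definition form_value :: "nat \<Rightarrow> 'k::field proj_line \<Rightarrow> 'k poly \<Rightarrow> 'k" where
  "form_value N P g = (case P of Affine a \<Rightarrow> poly g a | At_Infinity \<Rightarrow> coeff g N)"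

definition has_value :: "'k::field proj_line \<Rightarrow> 'k poly fract \<Rightarrow> 'k \<Rightarrow> bool" where
  "has_value P f c \<longleftrightarrow> (\<exists>N g h. degree g \<le> N \<and> degree h \<le> N \<and> form_value N P h \<noteq> 0 \<and>
     f = Fract g h \<and> form_value N P g = c * form_value N P h)"

lemma has_valueI:
  "degree g \<le> N \<Longrightarrow> degree h \<le> N \<Longrightarrow> form_value N P h \<noteq> 0 \<Longrightarrow> f = Fract g h \<Longrightarrow>
     form_value N P g = c * form_value N P h \<Longrightarrow> has_value P f c"
  unfolding has_value_def by blast

lemma form_value_0 [simp]: "form_value N P 0 = 0"
  by (cases P) (simp_all add: form_value_def)

lemma form_value_add: "form_value N P (g + h) = form_value N P g + form_value N P h"
  by (cases P) (simp_all add: form_value_def)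

lemma coeff_mult_degree_le:
  assumes "degree g \<le> N" "degree h \<le> M"
  shows "coeff (g * h) (N + M) = coeff g N * coeff h M"
proof -
  have "coeff g i * coeff h (N + M - i) = (if i = N then coeff g N * coeff h M else 0)"
    if "i \<le> N + M" for i
  proof (cases i N rule: linorder_cases)
    case less
    then have "coeff h (N + M - i) = 0" using assms by (intro coeff_eq_0) simp
    then show ?thesis using less by simp
  next
    case greater
    then have "coeff g i = 0" using assms by (intro coeff_eq_0) simp
    then show ?thesis using greater by simp
  qed simp
  then have "coeff (g * h) (N + M) = (\<Sum>i\<le>N + M. if i = N then coeff g N * coeff h M else 0)"
    unfolding coeff_mult by (intro sum.cong) auto
  then show ?thesis by simp
qed

lemma form_value_mult:
  "degree g \<le> N \<Longrightarrow> degree h \<le> M \<Longrightarrow>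
     form_value (N + M) P (g * h) = form_value N P g * form_value M P h"
  by (cases P) (simp_all add: form_value_def coeff_mult_degree_le)

lemma degree_mult_le_add: "degree g \<le> N \<Longrightarrow> degree h \<le> M \<Longrightarrow> degree (g * h) \<le> N + M"
  using degree_mult_le[of g h] by linarith

lemma has_value_const: "has_value P (const_fract c) c"
  by (rule has_valueI[of "[:c:]" 0 1]) (cases P; simp add: const_fract_def form_value_def)+

lemma has_value_mult:
  assumes "has_value P f c" "has_value P f' c'"
  shows "has_value P (f * f') (c * c')"
proof -
  obtain N g h where 1: "degree g \<le> N" "degree h \<le> N" "form_value N P h \<noteq> 0"
      "f = Fract g h" "form_value N P g = c * form_value N P h"
    using assms(1) unfolding has_value_def by blast
  obtain M g' h' where 2: "degree g' \<le> M" "degree h' \<le> M" "form_value M P h' \<noteq> 0"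
      "f' = Fract g' h'" "form_value M P g' = c' * form_value M P h'"
    using assms(2) unfolding has_value_def by blast
  show ?thesis
    by (rule has_valueI[of "g * g'" "N + M" "h * h'"])
      (use 1 2 in \<open>simp_all add: degree_mult_le_add form_value_mult\<close>)
qed

lemma has_value_add:
  assumes "has_value P f c" "has_value P f' c'"
  shows "has_value P (f + f') (c + c')"
proof -
  obtain N g h where 1: "degree g \<le> N" "degree h \<le> N" "form_value N P h \<noteq> 0"
      "f = Fract g h" "form_value N P g = c * form_value N P h"
    using assms(1) unfolding has_value_def by blast
  obtain M g' h' where 2: "degree g' \<le> M" "degree h' \<le> M" "form_value M P h' \<noteq> 0"
      "f' = Fract g' h'" "form_value M P g' = c' * form_value M P h'"
    using assms(2) unfolding has_value_def by blast
  have nz: "h \<noteq> 0" "h' \<noteq> 0" using 1(3) 2(3) by auto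
  have "form_value (N + M) P (g * h' + g' * h) = (c + c') * form_value (N + M) P (h * h')"
    using 1(5) 2(5) form_value_mult[OF 1(1) 2(2), of P] form_value_mult[OF 1(2) 2(2), of P]
      form_value_mult[OF 2(1) 1(2), of P, unfolded add.commute[of M N]]
    by (simp only: form_value_add) (simp only: algebra_simps)
  moreover have "degree (g * h' + g' * h) \<le> N + M"
    using 1 2 degree_mult_le_add[of g' M h N, unfolded add.commute[of M N]]
    by (intro degree_add_le) (simp_all add: degree_mult_le_add)
  ultimately show ?thesis
    by (intro has_valueI[of "g * h' + g' * h" "N + M" "h * h'"])
      (use 1 2 nz in \<open>simp_all add: degree_mult_le_add form_value_mult\<close>)
qed

lemma has_value_inverse:
  assumes "has_value P f c" "c \<noteq> 0"
  shows "has_value P (inverse f) (inverse c)"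
proof -
  obtain N g h where 1: "degree g \<le> N" "degree h \<le> N" "form_value N P h \<noteq> 0"
      "f = Fract g h" "form_value N P g = c * form_value N P h"
    using assms(1) unfolding has_value_def by blast
  show ?thesis by (rule has_valueI[of h N g]) (use 1 assms(2) in simp_all)
qed

lemma has_value_power: "has_value P f c \<Longrightarrow> has_value P (f ^ n) (c ^ n)"
  by (induction n) (use has_value_const[of P 1] in \<open>simp_all add: has_value_mult\<close>)

lemma has_value_power_int:
  "has_value P f c \<Longrightarrow> c \<noteq> 0 \<Longrightarrow> has_value P (f powi n) (c powi n)"
  unfolding power_int_def by (simp add: has_value_power has_value_inverse)

lemma has_value_prod:
  "(\<And>i. i \<in> I \<Longrightarrow> has_value P (f i) (c i)) \<Longrightarrow> has_value P (\<Prod>i\<in>I. f i) (\<Prod>i\<in>I. c i)"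
  by (induction I rule: infinite_finite_induct)
    (use has_value_const[of P 1] in \<open>simp_all add: has_value_mult\<close>)

lemma has_value_sum:
  "(\<And>i. i \<in> I \<Longrightarrow> has_value P (f i) (c i)) \<Longrightarrow> has_value P (\<Sum>i\<in>I. f i) (\<Sum>i\<in>I. c i)"
  by (induction I rule: infinite_finite_induct)
    (use has_value_const[of P 0] in \<open>simp_all add: has_value_add\<close>)

lemma has_value_zero_iff: "has_value P 0 c \<longleftrightarrow> c = 0"
proof
  assume "has_value P 0 c"
  then obtain N g h where 1: "form_value N P h \<noteq> 0"
      "0 = Fract g h" "form_value N P g = c * form_value N P h"
    unfolding has_value_def by blast
  then have "h \<noteq> 0" by auto
  then have "g = 0" using 1(2) by (simp add: Zero_fract_def eq_fract)
  then show "c = 0" using 1 by simp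
qed (use has_value_const[of P 0] in simp)

text \<open>
  Over a finite field \<open>1 + \<Prod>\<^sub>a (x - a)\<close> would have no root.
\<close>

lemma infinite_UNIV_alg_closed: "infinite (UNIV :: 'k::alg_closed_field set)"
proof
  assume fin: "finite (UNIV :: 'k set)"
  define F :: "'k poly" where "F = (\<Prod>a\<in>UNIV. [:-a, 1:]) + 1"
  have val: "poly F x = 1" for x
    using fin by (simp add: F_def poly_prod prod_zero_iff)
  have "F = 1"
  proof (rule ccontr)
    assume "F \<noteq> 1"
    then have "(\<Prod>a\<in>(UNIV::'k set). [:-a, 1:]) \<noteq> (0 :: 'k poly)"
      using fin by simp
    moreover have deg: "degree (\<Prod>a\<in>(UNIV::'k set). [:-a, 1:]) = card (UNIV :: 'k set)"
      by (simp add: degree_prod_eq_sum_degree)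
    moreover have "card (UNIV :: 'k set) > 0" using fin by (simp add: finite_UNIV_card_ge_0)
    ultimately have "degree F > 0" unfolding F_def by (subst degree_add_eq_left) auto
    then obtain x where "poly F x = 0" using alg_closed_imp_poly_has_root by blast
    then show False using val by simp
  qed
  then have "(\<Prod>a\<in>(UNIV::'k set). [:-a, 1:]) = (0 :: 'k poly)" by (simp add: F_def)
  then show False using fin by (simp add: prod_zero_iff)
qed

context torus_line
begin

lemma has_value_restr_Laurent:
  assumes "\<forall>i. line_point p q P $ i \<noteq> 0"
  shows "has_value P (restr_Laurent g)
    (eval_Laurent g (\<chi> j. line_point p q P $ Some j / line_point p q P $ None))"
proof -
  have val: "form_value 1 P (lform i) = line_point p q P $ i" for i
    by (cases P) (simp_all add: form_value_def lform_def line_point_def)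
  have "has_value P (z_restr p q j) (line_point p q P $ Some j / line_point p q P $ None)" for j
    by (rule has_valueI[of "lform (Some j)" 1 "lform None"])
      (simp_all only: val, simp_all add: assms lform_def z_restr_def)
  then have "has_value P (zmon v) (\<Prod>j\<in>UNIV. (line_point p q P $ Some j / line_point p q P $ None) powi (v $ j))" for v
    unfolding zmon_def using assms by (intro has_value_prod has_value_power_int) auto
  then show ?thesis
    unfolding restr_Laurent_def eval_Laurent_def
    by (intro has_value_sum has_value_mult has_value_const) simp
qed

text \<open>
  A rational function on \<open>L\<close> that vanishes identically has value \<open>0\<close> at every point of \<open>L\<^sup>\<circ>\<close>.
  Conversely, all but finitely many points of \<open>L\<close> lie in \<open>L\<^sup>\<circ>\<close>, and only the zero function has
  infinitely many zeros.
\<close>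

lemma restr_Laurent_eq_0_iff: "restr_Laurent g = 0 \<longleftrightarrow> g \<in> ideal_line p q"
proof
  assume "restr_Laurent g = 0"
  then have "eval_Laurent g x = 0" if "x \<in> line_torus p q" for x
    using that has_value_restr_Laurent[of _ g] unfolding line_torus_def
    by (auto simp: has_value_zero_iff)
  then show "g \<in> ideal_line p q" by (simp add: ideal_line_def)
next
  assume g: "g \<in> ideal_line p q"
  obtain a b where ab: "restr_Laurent g = Fract a b" "b \<noteq> 0" by (cases "restr_Laurent g")
  have "a = 0"
  proof (rule ccontr)
    assume "a \<noteq> 0"
    then have "a * (\<Prod>i\<in>UNIV. lform i) \<noteq> 0" by (simp add: lform_nonzero)
    then have "finite {x. poly (a * (\<Prod>i\<in>UNIV. lform i)) x = 0}" by (rule poly_roots_finite)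
    then obtain x where x: "poly (a * (\<Prod>i\<in>UNIV. lform i)) x \<noteq> 0"
      using infinite_UNIV_alg_closed[where 'k = 'k] by (metis (mono_tags, lifting) UNIV_eq_I mem_Collect_eq)
    then have nz: "\<forall>i. line_point p q (Affine x) $ i \<noteq> 0"
      by (auto simp: poly_prod lform_def line_point_def)
    have "(\<chi> j. line_point p q (Affine x) $ Some j / line_point p q (Affine x) $ None) \<in> line_torus p q"
      using nz unfolding line_torus_def by blast
    then have "has_value (Affine x) (Fract a b) 0"
      using has_value_restr_Laurent[OF nz, of g] g by (simp add: ideal_line_def ab(1))
    then obtain N a' b' where *: "form_value N (Affine x) b' \<noteq> 0" "Fract a b = Fract a' b'"
        "form_value N (Affine x) a' = 0"
      unfolding has_value_def by auto
    then have "b' \<noteq> 0" by auto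
    then have "a * b' = a' * b" using * ab(2) by (simp add: eq_fract)
    then have "poly a x * poly b' x = poly a' x * poly b x" by (metis poly_mult)
    then have "poly a x = 0" using * by (simp add: form_value_def)
    then show False using x by simp
  qed
  then show "restr_Laurent g = 0" using ab by (simp add: Zero_fract_def eq_fract)
qed

end

section \<open>Global sections\<close>

lemma ord_at_mult:
  assumes "f \<noteq> 0" "f' \<noteq> 0"
  shows "ord_at P (f * f') = ord_at P f + ord_at P f'"
proof -
  obtain g h g' h' where "f = Fract g h" "h \<noteq> 0" "f' = Fract g' h'" "h' \<noteq> 0"
    by (cases f, cases f')
  moreover from this assms have "g \<noteq> 0" "g' \<noteq> 0" by (auto simp: Zero_fract_def eq_fract)
  ultimately show ?thesis by (simp add: ord_at_Fract ord_poly_mult)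
qed

lemma ord_at_const: "c \<noteq> 0 \<Longrightarrow> ord_at P (const_fract c) = 0"
  by (cases P) (simp_all add: const_fract_def ord_at_Fract ord_poly_def order_0I)

lemma ord_at_1 [simp]: "ord_at P 1 = 0"
  using ord_at_const[of 1 P] by simp

lemma ord_at_inverse: "f \<noteq> 0 \<Longrightarrow> ord_at P (inverse f) = - ord_at P f"
  using ord_at_mult[of f "inverse f" P] by simp

lemma ord_at_power: "f \<noteq> 0 \<Longrightarrow> ord_at P (f ^ n) = int n * ord_at P f"
  by (induction n) (simp_all add: ord_at_mult algebra_simps)

lemma ord_at_power_int: "f \<noteq> 0 \<Longrightarrow> ord_at P (f powi n) = n * ord_at P f"
  by (cases "n \<ge> 0") (simp_all add: power_int_def ord_at_power ord_at_inverse)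

lemma ord_at_prod:
  "(\<And>i. i \<in> I \<Longrightarrow> f i \<noteq> 0) \<Longrightarrow> ord_at P (\<Prod>i\<in>I. f i) = (\<Sum>i\<in>I. ord_at P (f i))"
  by (induction I rule: infinite_finite_induct) (simp_all add: ord_at_mult)

lemma ord_poly_add:
  assumes "g \<noteq> 0" "h \<noteq> 0" "g + h \<noteq> 0"
  shows "min (ord_poly P g) (ord_poly P h) \<le> ord_poly P (g + h)"
proof (cases P)
  case (Affine a)
  let ?n = "min (Polynomial.order a g) (Polynomial.order a h)"
  have "[:-a, 1:] ^ ?n dvd g + h" by (intro dvd_add) (simp_all add: order_divides)
  then have "?n \<le> Polynomial.order a (g + h)" using assms(3) by (simp add: order_divides)
  then show ?thesis by (simp add: Affine ord_poly_def)
next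
  case At_Infinity
  have "degree (g + h) \<le> max (degree g) (degree h)" by (rule degree_add_le_max)
  then show ?thesis by (auto simp: At_Infinity ord_poly_def)
qed

lemma ord_at_add:
  assumes "f \<noteq> 0" "f' \<noteq> 0" "f + f' \<noteq> 0"
  shows "min (ord_at P f) (ord_at P f') \<le> ord_at P (f + f')"
proof -
  obtain g h g' h' where f: "f = Fract g h" "h \<noteq> 0" "f' = Fract g' h'" "h' \<noteq> 0"
    by (cases f, cases f')
  have nz: "g \<noteq> 0" "g' \<noteq> 0" using f assms by (auto simp: Zero_fract_def eq_fract)
  have sum: "f + f' = Fract (g * h' + g' * h) (h * h')" using f by simp
  have nz': "g * h' + g' * h \<noteq> 0" using assms(3) f(2,4) unfolding sum by (auto simp: Zero_fract_def eq_fract)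
  have "min (ord_poly P (g * h')) (ord_poly P (g' * h)) \<le> ord_poly P (g * h' + g' * h)"
    using nz nz' f by (intro ord_poly_add) auto
  then show ?thesis
    unfolding sum using f nz nz' by (simp add: ord_at_Fract ord_poly_mult)
qed

lemma global_sections_add:
  assumes "f \<in> global_sections D" "f' \<in> global_sections D"
  shows "f + f' \<in> global_sections D"
proof (cases "f = 0 \<or> f' = 0 \<or> f + f' = 0")
  case True
  then show ?thesis using assms by (auto simp: global_sections_def)
next
  case False
  have "0 \<le> Fin (ord_at P (f + f')) + D P" for P
  proof -
    have "0 \<le> Fin (ord_at P f) + D P" "0 \<le> Fin (ord_at P f') + D P"
      using assms False by (auto simp: global_sections_def)
    then show ?thesis
      using ord_at_add[of f f' P] False by (cases "D P") (auto simp: zero_extended_def)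
  qed
  then show ?thesis by (simp add: global_sections_def)
qed

lemma global_sections_sum:
  "(\<And>i. i \<in> I \<Longrightarrow> f i \<in> global_sections D) \<Longrightarrow> (\<Sum>i\<in>I. f i) \<in> global_sections D"
proof (induction I rule: infinite_finite_induct)
  case (insert i I)
  then show ?case by (simp add: global_sections_add)
qed (simp_all add: global_sections_def)

text \<open>
  A zero of the denominator is also a zero of the numerator, and the common linear factor cancels.
\<close>

lemma fract_eq_poly:
  fixes g h :: "'k::alg_closed_field poly"
  shows "g \<noteq> 0 \<Longrightarrow> h \<noteq> 0 \<Longrightarrow> (\<forall>a. 0 \<le> ord_at (Affine a) (Fract g h)) \<Longrightarrow> \<exists>F. Fract g h = Fract F 1"
proof (induction "degree h" arbitrary: g h)
  case 0
  then obtain c where c: "h = [:c:]" using degree_eq_zeroE[of h] by auto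
  with 0 have "c \<noteq> 0" by simp
  with c have "Fract g h = Fract (smult (inverse c) g) 1" by (simp add: eq_fract)
  then show ?case by blast
next
  case (Suc n)
  then obtain a where a: "poly h a = 0" using alg_closed_imp_poly_has_root[of h] by auto
  then obtain h' where h': "h = [:-a, 1:] * h'" by (meson dvdE poly_eq_0_iff_dvd)
  have "0 \<le> ord_at (Affine a) (Fract g h)" using Suc.prems by blast
  then have "Polynomial.order a h \<le> Polynomial.order a g" using Suc.prems by (simp add: ord_at_Fract ord_poly_def)
  moreover have "Polynomial.order a h \<noteq> 0" using a Suc.prems(2) order_root by blast
  ultimately have "Polynomial.order a g \<noteq> 0" by simp
  then have "poly g a = 0" using order_root by blast
  then obtain g' where g': "g = [:-a, 1:] * g'" by (meson dvdE poly_eq_0_iff_dvd)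
  have nz: "g' \<noteq> 0" "h' \<noteq> 0" using Suc.prems g' h' by auto
  have eq: "Fract g h = Fract g' h'"
    unfolding g' h' by (rule mult_fract_cancel) simp
  have "degree h = Suc (degree h')" unfolding h' using nz by (subst degree_mult_eq) auto
  then have "n = degree h'" using Suc.hyps(2) by simp
  from Suc.hyps(1)[OF this nz] show ?case using Suc.prems(3) unfolding eq by blast
qed

lemma sum_Fin: "(\<Sum>i\<in>I. Fin (e i)) = Fin (\<Sum>i\<in>I. e i)" for e :: "'i \<Rightarrow> int"
  by (induction I rule: infinite_finite_induct) (simp_all add: zero_extended_def)

lemma sum_extended_nonneg:
  fixes d :: "'i \<Rightarrow> int extended"
  shows "(\<And>i. i \<in> I \<Longrightarrow> 0 \<le> d i) \<Longrightarrow> 0 \<le> (\<Sum>i\<in>I. d i)"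
proof (induction I rule: infinite_finite_induct)
  case (insert i I)
  then have "0 + 0 \<le> d i + (\<Sum>i\<in>I. d i)" by (intro add_mono) auto
  then show ?case using insert by simp
qed simp_all

text \<open>
  A single section has poles of bounded order, so infinite coefficients of the divisor may be replaced
  by finite ones.
\<close>

lemma finite_truncation:
  fixes D :: "'i::finite \<Rightarrow> int extended" and Q :: "'i \<Rightarrow> 'k::field proj_line"
  assumes D: "\<And>i. D i \<noteq> -\<infinity>" and F: "\<And>P. 0 \<le> Fin (ordf P) + (\<Sum>i | Q i = P. D i)"
  shows "\<exists>e. (\<forall>i. Fin (e i) \<le> D i) \<and> (\<forall>P. 0 \<le> ordf P + (\<Sum>i | Q i = P. e i))"
proof -
  define c where "c i = (case D i of Fin d \<Rightarrow> \<bar>d\<bar> | _ \<Rightarrow> 0)" for i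
  \<comment> \<open>A coefficient that outweighs the order of pole and the finite coefficients at the same point.\<close>
  define B where "B = (\<Sum>j\<in>UNIV. \<bar>ordf (Q j)\<bar>) + (\<Sum>j\<in>UNIV. c j)"
  define e where "e i = (case D i of Fin d \<Rightarrow> d | _ \<Rightarrow> B)" for i
  have c0: "0 \<le> c i" for i by (simp add: c_def split: extended.splits)
  have B0: "0 \<le> B" unfolding B_def using c0 by (intro add_nonneg_nonneg sum_nonneg) auto
  have ce: "- c i \<le> e i" for i using B0 c0 by (cases "D i") (auto simp: c_def e_def)
  have "Fin (e i) \<le> D i" for i using D[of i] by (cases "D i") (auto simp: e_def)
  moreover have "0 \<le> ordf P + (\<Sum>i | Q i = P. e i)" for P
  proof (cases "\<exists>i. Q i = P \<and> D i = \<infinity>")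
    case True
    then obtain i where i: "Q i = P" "D i = \<infinity>" by blast
    have "\<bar>ordf (Q i)\<bar> \<le> (\<Sum>j\<in>UNIV. \<bar>ordf (Q j)\<bar>)" by (rule member_le_sum) auto
    moreover have "(\<Sum>j | Q j = P \<and> j \<noteq> i. c j) \<le> (\<Sum>j\<in>UNIV. c j)"
      using c0 by (intro sum_mono2) auto
    moreover have "(\<Sum>j | Q j = P \<and> j \<noteq> i. - c j) \<le> (\<Sum>j | Q j = P \<and> j \<noteq> i. e j)"
      using ce by (intro sum_mono) auto
    moreover have "(\<Sum>j | Q j = P. e j) = e i + (\<Sum>j | Q j = P \<and> j \<noteq> i. e j)"
    proof -
      have "{j. Q j = P} - {i} = {j. Q j = P \<and> j \<noteq> i}" by auto
      then show ?thesis using i by (simp add: sum.remove[of _ i])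
    qed
    moreover have "e i = B" using i by (simp add: e_def)
    ultimately show ?thesis using i by (simp add: B_def sum_negf)
  next
    case False
    then have "D i = Fin (e i)" if "Q i = P" for i
      using that D[of i] by (cases "D i") (auto simp: e_def)
    then have "(\<Sum>i | Q i = P. D i) = Fin (\<Sum>i | Q i = P. e i)"
      by (simp add: sum_Fin)
    then show ?thesis using F[of P] by (simp add: zero_extended_def)
  qed
  ultimately show ?thesis by blast
qed

context torus_line
begin

lemma Q_point_eq: "Q_point p q i = (if q $ i = 0 then At_Infinity else Affine (- p $ i / q $ i))"
proof -
  have nz: "q $ i = 0 \<Longrightarrow> p $ i \<noteq> 0" using lform_nonzero[of i] by (auto simp: lform_def)
  have "p $ i + x * q $ i = 0 \<longleftrightarrow> x = - p $ i / q $ i" if "q $ i \<noteq> 0" for x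
    using that by (metis add.commute eq_divide_eq eq_neg_iff_add_eq_0)
  then have "line_point p q P $ i = 0 \<longleftrightarrow>
      P = (if q $ i = 0 then At_Infinity else Affine (- p $ i / q $ i))" for P
    by (cases P) (simp_all add: line_point_def nz)
  then show ?thesis unfolding Q_point_def by simp
qed

lemma ord_at_lfun:
  "ord_at P (lfun i) = (if Q_point p q i = P then 1 else 0) - (if P = At_Infinity then 1 else 0)"
proof (cases P)
  case (Affine a)
  have "Polynomial.order a (lform i) = (if Q_point p q i = Affine a then 1 else 0)"
  proof (cases "q $ i = 0")
    case True
    then have "poly (lform i) a \<noteq> 0" using lform_nonzero[of i] by (auto simp: lform_def)
    then show ?thesis using True by (simp add: Q_point_eq order_0I)
  next
    case False
    show ?thesis
    proof (cases "a = - p $ i / q $ i")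
      case True
      then have "lform i = smult (q $ i) [:-a, 1:]" using False by (simp add: lform_def)
      then have "Polynomial.order a (lform i) = Polynomial.order a ([:-a, 1:] ^ 1)"
        using False by (simp only: order_smult power_one_right not_False_eq_True)
      also have "\<dots> = 1" by (rule order_power_n_n)
      finally show ?thesis using True False by (simp add: Q_point_eq)
    next
      case neq: False
      then have "poly (lform i) a \<noteq> 0"
        using False by (auto simp: lform_def field_simps add_eq_0_iff)
      then show ?thesis using neq False by (simp add: Q_point_eq order_0I)
    qed
  qed
  then show ?thesis
    using lform_nonzero[of i] by (simp add: Affine lfun_def ord_at_Fract ord_poly_def)
next
  case At_Infinity
  then show ?thesis
    using lform_nonzero[of i]
    by (simp add: lfun_def ord_at_Fract ord_poly_def Q_point_eq) (simp add: lform_def)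
qed

text \<open>
  Each linear form has one zero \<open>Q\<^sub>i\<close> and, as a function of \<open>x\<close>, a pole at infinity; these cancel for
  the form with \<open>Q\<^sub>i\<close> at infinity.
\<close>

lemma ord_at_lmon:
  "ord_at P (lmon d) = (\<Sum>i | Q_point p q i = P. d i) - (if P = At_Infinity then \<Sum>i\<in>UNIV. d i else 0)"
proof -
  have "ord_at P (lmon d) = (\<Sum>i\<in>UNIV. d i * ord_at P (lfun i))"
    by (simp add: lmon_def ord_at_prod ord_at_power_int lfun_nonzero)
  also have "\<dots> = (\<Sum>i\<in>UNIV. if Q_point p q i = P then d i else 0)
      - (\<Sum>i\<in>UNIV. if P = At_Infinity then d i else 0)"
    unfolding sum_subtractf[symmetric] by (intro sum.cong) (auto simp: ord_at_lfun)
  also have "(\<Sum>i\<in>UNIV. if Q_point p q i = P then d i else 0) = (\<Sum>i | Q_point p q i = P. d i)"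
    by (simp add: sum.inter_filter[symmetric])
  finally show ?thesis by (cases "P = At_Infinity") simp_all
qed

text \<open>
  The divisor of \<open>z\<^sup>v\<close> on \<open>L\<close> is \<open>\<Sum>\<^sub>i \<langle>e\<^sub>i, v\<rangle> Q\<^sub>i\<close>, so the inequalities for all \<open>i\<close> add up at each point.
\<close>

lemma zmon_global_section:
  assumes "\<And>i. 0 \<le> D i + Fin (homog_exp v i)"
  shows "const_fract c * zmon v \<in> global_sections (\<lambda>P. \<Sum>i | Q_point p q i = P. D i)"
proof (cases "c = 0")
  case False
  have "0 \<le> Fin (ord_at P (const_fract c * zmon v)) + (\<Sum>i | Q_point p q i = P. D i)" for P
  proof -
    have "const_fract c \<noteq> 0" using False by (simp add: const_fract_def Zero_fract_def eq_fract)
    then have "ord_at P (const_fract c * zmon v) = (\<Sum>i | Q_point p q i = P. homog_exp v i)"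
      using False by (simp add: zmon_eq_lmon ord_at_mult ord_at_const lmon_nonzero ord_at_lmon sum_homog_exp)
    then have "Fin (ord_at P (const_fract c * zmon v)) + (\<Sum>i | Q_point p q i = P. D i)
        = (\<Sum>i | Q_point p q i = P. D i + Fin (homog_exp v i))"
      by (simp add: sum.distrib sum_Fin add.commute)
    then show ?thesis using sum_extended_nonneg[OF assms] by simp
  qed
  then show ?thesis by (simp add: global_sections_def)
qed (simp add: global_sections_def)

text \<open>Two of the \<open>y\<^sub>i\<close> restrict to a basis of the linear forms on the line.\<close>

lemma exists_independent_forms: "\<exists>i j. p $ i * q $ j - p $ j * q $ i \<noteq> 0"
proof (rule ccontr)
  assume "\<not> ?thesis"
  then have *: "p $ i * q $ j = p $ j * q $ i" for i j by auto
  have "p \<noteq> 0" using indep[unfolded lin_indep_def, rule_format, of 1 0] by auto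
  then obtain i where i: "p $ i \<noteq> 0" by (auto simp: vec_eq_iff)
  have "q $ i *s p + (- p $ i) *s q = 0" using *[of i] by (simp add: vec_eq_iff mult.commute)
  then show False using indep i unfolding lin_indep_def by fastforce
qed

text \<open>
  Forms of degree \<open>n\<close> on \<open>\<pp>\<^sup>m\<close> restrict onto the forms of degree \<open>n\<close> on \<open>L\<close>, where forms on \<open>L\<close> are
  polynomials in \<open>x\<close>.  Dividing by \<open>\<Prod>\<^sub>i y\<^sub>i\<^bsup>d\<^sub>i\<^esup>\<close> with \<open>\<Sum>\<^sub>i d\<^sub>i = n\<close> makes them Laurent polynomials
  with exponents at least \<open>-d\<^sub>i\<close>.  In the induction, \<open>F = c + x G\<close> is written as a combination of two
  linear forms with coefficients of degree at most \<open>n\<close>, and a factor \<open>y\<^sub>i\<close> is traded for lowering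
  \<open>d\<^sub>i\<close> by one.
\<close>

lemma lift_polynomial:
  "degree F \<le> n \<Longrightarrow> (\<Sum>i\<in>UNIV. d i) = int n \<Longrightarrow>
     \<exists>g. (\<forall>v\<in>Poly_Mapping.keys g. \<forall>i. - d i \<le> homog_exp v i) \<and>
         restr_Laurent g = Fract F 1 * lmon (\<lambda>i. - d i)"
proof (induction n arbitrary: F d)
  case 0
  then obtain c where F: "F = [:c:]" by (metis degree_eq_zeroE le_zero_eq)
  have "(\<Sum>i\<in>UNIV. - d i) = 0" using 0 by (simp add: sum_negf)
  then obtain v where v: "homog_exp v = (\<lambda>i. - d i)" using ex_homog_exp by blast
  have "restr_Laurent (Poly_Mapping.single v c) = Fract F 1 * lmon (\<lambda>i. - d i)"
    by (simp add: restr_Laurent_single F const_fract_def zmon_eq_lmon v)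
  then show ?case using v by (intro exI[of _ "Poly_Mapping.single v c"]) simp
next
  case (Suc n)
  obtain c G where F: "F = pCons c G" by (cases F)
  have G: "degree G \<le> n" using Suc.prems(1) F by (cases "G = 0") auto
  obtain i j where ij: "p $ i * q $ j - p $ j * q $ i \<noteq> 0" using exists_independent_forms by blast
  \<comment> \<open>\<open>A\<close> and \<open>B\<close> come from solving for \<open>1\<close> and \<open>x\<close> in terms of the two linear forms by Cramer's rule.\<close>
  define r where "r = inverse (p $ i * q $ j - p $ j * q $ i)"
  define A where "A = [:r * c * q $ j:] - smult (r * p $ j) G"
  define B where "B = smult (r * p $ i) G - [:r * c * q $ i:]"
  have r: "r * (p $ i * q $ j - p $ j * q $ i) = 1" using ij by (simp add: r_def)
  have deg: "degree A \<le> n" "degree B \<le> n"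
    unfolding A_def B_def using G by (auto intro!: degree_diff_le order_trans[OF degree_smult_le])
  have "F = lform i * A + lform j * B"
  proof -
    have lf: "lform k = [:p $ k:] + [:q $ k:] * [:0, 1:]" for k by (simp add: lform_def)
    have A: "A = [:r:] * ([:c:] * [:q $ j:] - [:p $ j:] * G)"
      and B: "B = [:r:] * ([:p $ i:] * G - [:c:] * [:q $ i:])"
      by (simp_all add: A_def B_def smult_diff_right mult.assoc)
    have "lform i * A + lform j * B =
        [:r:] * ([:p $ i:] * [:q $ j:] - [:p $ j:] * [:q $ i:]) * ([:c:] + [:0, 1:] * G)"
      unfolding lf A B by (simp only: algebra_simps)
    also have "[:r:] * ([:p $ i:] * [:q $ j:] - [:p $ j:] * [:q $ i:]) = 1"
      using r by (simp add: one_pCons mult_ac)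
    finally show ?thesis by (simp add: F)
  qed
  then have FE: "Fract F 1 = lfun i * Fract A 1 + lfun j * Fract B 1"
    by (simp add: lfun_def)
  define dec where "dec k = (\<lambda>l. d l - (if l = k then 1 else 0))" for k
  have sum_dec: "(\<Sum>l\<in>UNIV. dec k l) = int n" for k
    using Suc.prems(2) by (simp add: dec_def sum_subtractf)
  have lmon_dec: "lmon (\<lambda>l. - dec k l) = lfun k * lmon (\<lambda>l. - d l)" for k
  proof -
    have "(\<lambda>l. - dec k l) = (\<lambda>l. (if l = k then 1 else 0) + - d l)" by (auto simp: dec_def)
    then show ?thesis by (simp only: lmon_add lmon_delta)
  qed
  obtain g1 where g1: "\<forall>v\<in>Poly_Mapping.keys g1. \<forall>l. - dec i l \<le> homog_exp v l"
      "restr_Laurent g1 = Fract A 1 * lmon (\<lambda>l. - dec i l)"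
    using Suc.IH[OF deg(1) sum_dec] by blast
  obtain g2 where g2: "\<forall>v\<in>Poly_Mapping.keys g2. \<forall>l. - dec j l \<le> homog_exp v l"
      "restr_Laurent g2 = Fract B 1 * lmon (\<lambda>l. - dec j l)"
    using Suc.IH[OF deg(2) sum_dec] by blast
  have "- d l \<le> homog_exp v l" if v: "v \<in> Poly_Mapping.keys (g1 + g2)" for v l
  proof -
    have le: "- d l \<le> - dec k l" for k by (simp add: dec_def)
    have "v \<in> Poly_Mapping.keys g1 \<or> v \<in> Poly_Mapping.keys g2"
      using v Poly_Mapping.keys_add[of g1 g2] by blast
    then show ?thesis using g1(1) g2(1) le order_trans by blast
  qed
  moreover have "restr_Laurent (g1 + g2) = Fract F 1 * lmon (\<lambda>l. - d l)"
    by (simp add: restr_Laurent_add g1(2) g2(2) lmon_dec FE algebra_simps)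
  ultimately show ?case by blast
qed

text \<open>
  A section \<open>f\<close> of \<open>\<Sum>\<^sub>i e\<^sub>i Q\<^sub>i\<close> becomes a polynomial after multiplication with \<open>\<Prod>\<^sub>i y\<^sub>i\<^bsup>e\<^sub>i\<^esup>\<close>, and the
  condition at infinity bounds its degree by \<open>\<Sum>\<^sub>i e\<^sub>i\<close>.
\<close>

lemma lift_global_section:
  assumes D: "\<And>i. D i \<noteq> -\<infinity>" and f: "f \<in> global_sections (\<lambda>P. \<Sum>i | Q_point p q i = P. D i)"
  obtains g where "restr_Laurent g = f"
    "\<And>v i. v \<in> Poly_Mapping.keys g \<Longrightarrow> 0 \<le> D i + Fin (homog_exp v i)"
proof (cases "f = 0")
  case True
  show thesis by (rule that[of 0]) (simp_all add: True)
next
  case False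
  then have "0 \<le> Fin (ord_at P f) + (\<Sum>i | Q_point p q i = P. D i)" for P
    using f by (simp add: global_sections_def)
  with D have "\<exists>e. (\<forall>i. Fin (e i) \<le> D i) \<and> (\<forall>P. 0 \<le> ord_at P f + (\<Sum>i | Q_point p q i = P. e i))"
    by (rule finite_truncation)
  then obtain e where e: "\<And>i. Fin (e i) \<le> D i"
      "\<And>P. 0 \<le> ord_at P f + (\<Sum>i | Q_point p q i = P. e i)"
    by blast
  have nz: "f * lmon e \<noteq> 0" using False lmon_nonzero by simp
  obtain a b where ab: "f * lmon e = Fract a b" "b \<noteq> 0" by (cases "f * lmon e")
  have "a \<noteq> 0" using nz ab by (auto simp: Zero_fract_def eq_fract)
  moreover have "\<forall>x. 0 \<le> ord_at (Affine x) (Fract a b)"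
    using e(2) False by (simp add: ab(1)[symmetric] ord_at_mult lmon_nonzero ord_at_lmon)
  ultimately obtain F where F: "f * lmon e = Fract F 1" using fract_eq_poly[of a b] ab by auto
  have "F \<noteq> 0" using nz F by (auto simp: Zero_fract_def)
  then have "ord_at At_Infinity (f * lmon e) = - int (degree F)"
    by (simp add: F ord_at_Fract ord_poly_def)
  moreover have "- (\<Sum>i\<in>UNIV. e i) \<le> ord_at At_Infinity (f * lmon e)"
    using e(2)[of At_Infinity] False by (simp add: ord_at_mult lmon_nonzero ord_at_lmon)
  ultimately have deg: "int (degree F) \<le> (\<Sum>i\<in>UNIV. e i)" by simp
  then obtain g where g: "\<forall>v\<in>Poly_Mapping.keys g. \<forall>i. - e i \<le> homog_exp v i"
      "restr_Laurent g = Fract F 1 * lmon (\<lambda>i. - e i)"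
    using lift_polynomial[of F "nat (\<Sum>i\<in>UNIV. e i)" e] by auto
  show thesis
  proof (rule that)
    have "lmon e * lmon (\<lambda>i. - e i) = 1" by (simp add: lmon_0 flip: lmon_add)
    then show "restr_Laurent g = f" by (simp add: g(2) F[symmetric] mult.assoc)
    fix v i assume "v \<in> Poly_Mapping.keys g"
    then have "- e i \<le> homog_exp v i" using g(1) by blast
    then show "0 \<le> D i + Fin (homog_exp v i)"
      using e(1)[of i] by (cases "D i") (auto simp: zero_extended_def)
  qed
qed


end

section \<open>Closed embeddings from surjective ring homomorphisms\<close>

lemma SpecD:
  fixes R (structure)
  assumes "P \<in> Spec R"
  shows Spec_subset: "P \<subseteq> carrier R"
    and Spec_zero: "\<zero> \<in> P"
    and Spec_one: "\<one> \<notin> P"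
    and Spec_add: "x \<in> P \<Longrightarrow> y \<in> P \<Longrightarrow> x \<oplus> y \<in> P"
    and Spec_a_inv: "x \<in> P \<Longrightarrow> \<ominus> x \<in> P"
    and Spec_mult: "x \<in> P \<Longrightarrow> c \<in> carrier R \<Longrightarrow> c \<otimes> x \<in> P"
    and Spec_prime: "a \<in> carrier R \<Longrightarrow> b \<in> carrier R \<Longrightarrow> a \<otimes> b \<in> P \<Longrightarrow> a \<in> P \<or> b \<in> P"
proof -
  interpret primeideal P R using assms by (simp add: Spec_def)
  show "P \<subseteq> carrier R" by (rule a_subset)
  show "\<zero> \<in> P" by (rule additive_subgroup.zero_closed[OF additive_subgroup_axioms])
  show "\<one> \<notin> P" using I_notcarr one_imp_carrier by auto
  show "x \<in> P \<Longrightarrow> y \<in> P \<Longrightarrow> x \<oplus> y \<in> P" by (rule additive_subgroup.a_closed[OF additive_subgroup_axioms])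
  show "x \<in> P \<Longrightarrow> \<ominus> x \<in> P" by (rule additive_subgroup.a_inv_closed[OF additive_subgroup_axioms])
  show "x \<in> P \<Longrightarrow> c \<in> carrier R \<Longrightarrow> c \<otimes> x \<in> P" by (rule I_l_closed)
  show "a \<in> carrier R \<Longrightarrow> b \<in> carrier R \<Longrightarrow> a \<otimes> b \<in> P \<Longrightarrow> a \<in> P \<or> b \<in> P" by (rule I_prime)
qed

lemma topspace_zariski: "topspace (zariski R) = Spec R"
proof
  have "\<not> {\<one>\<^bsub>R\<^esub>} \<subseteq> P" "\<one>\<^bsub>R\<^esub> \<in> carrier R" if "P \<in> Spec R" for P
    using that Spec_one[of P R] by (auto simp: Spec_def primeideal_def cring_def intro: ring.ring_simprules(6))
  then have "openin (zariski R) (Spec R)"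
    unfolding openin_zariski
    by (cases "Spec R = {}") (blast, intro exI[of _ "{\<one>\<^bsub>R\<^esub>}"], auto)
  then show "Spec R \<subseteq> topspace (zariski R)"
    by (rule openin_subset)
  show "topspace (zariski R) \<subseteq> Spec R"
    unfolding topspace_def by (auto simp: openin_zariski)
qed

lemma closedin_zariski:
  "closedin (zariski R) F \<longleftrightarrow> (\<exists>S \<subseteq> carrier R. F = {P \<in> Spec R. S \<subseteq> P})"
proof
  assume "closedin (zariski R) F"
  then obtain S where S: "F \<subseteq> Spec R" "S \<subseteq> carrier R" "Spec R - F = {P \<in> Spec R. \<not> S \<subseteq> P}"
    by (auto simp: closedin_def topspace_zariski openin_zariski)
  then have "F = Spec R - {P \<in> Spec R. \<not> S \<subseteq> P}" by (metis double_diff order_refl)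
  also have "\<dots> = {P \<in> Spec R. S \<subseteq> P}" by auto
  finally show "\<exists>S \<subseteq> carrier R. F = {P \<in> Spec R. S \<subseteq> P}" using S(2) by metis
next
  assume "\<exists>S \<subseteq> carrier R. F = {P \<in> Spec R. S \<subseteq> P}"
  then obtain S where S: "S \<subseteq> carrier R" "F = {P \<in> Spec R. S \<subseteq> P}" by auto
  then have "F \<subseteq> Spec R" "Spec R - F = {P \<in> Spec R. \<not> S \<subseteq> P}" by auto
  then show "closedin (zariski R) F"
    unfolding closedin_def topspace_zariski openin_zariski using S(1) by metis
qed

lemma openin_basic: "a \<in> carrier R \<Longrightarrow> openin (zariski R) {P \<in> Spec R. a \<notin> P}"
  unfolding openin_zariski by (intro exI[of _ "{a}"]) auto

text \<open>
  Transitivity of equality of fractions: if \<open>x\<close> witnesses \<open>b/t = a/s\<close> and \<open>w\<close> witnesses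
  \<open>a/s = a'/s'\<close>, then \<open>w x s\<close> witnesses \<open>b/t = a'/s'\<close>.
\<close>

lemma loc_frac_eqI:
  fixes R (structure)
  assumes "cring R" and P: "P \<in> Spec R" and "a \<in> carrier R" "a' \<in> carrier R"
    and s: "s \<in> carrier R - P" and s': "s' \<in> carrier R - P" and w: "w \<in> carrier R - P"
    and eq: "w \<otimes>\<^bsub>R\<^esub> (s' \<otimes>\<^bsub>R\<^esub> a) = w \<otimes>\<^bsub>R\<^esub> (s \<otimes>\<^bsub>R\<^esub> a')"
  shows "loc_frac R P a s = loc_frac R P a' s'"
proof -
  interpret cring R by fact
  have sub: "loc_frac R P a s \<subseteq> loc_frac R P a' s'"
    if carr: "a \<in> carrier R" "a' \<in> carrier R" "s \<in> carrier R - P" "s' \<in> carrier R - P"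
      and eq: "w \<otimes> (s' \<otimes> a) = w \<otimes> (s \<otimes> a')" for a a' s s'
  proof safe
    fix b t assume "(b, t) \<in> loc_frac R P a s"
    then obtain x where bt: "b \<in> carrier R" "t \<in> carrier R - P" "x \<in> carrier R - P"
      and x: "x \<otimes> (t \<otimes> a) = x \<otimes> (s \<otimes> b)"
      by (auto simp: loc_frac_def)
    define y where "y = w \<otimes> (x \<otimes> s)"
    have y: "y \<in> carrier R - P"
      using w bt carr Spec_prime[OF P] unfolding y_def by (metis DiffD1 DiffD2 DiffI m_closed)
    have "y \<otimes> (t \<otimes> a') = (x \<otimes> t) \<otimes> (w \<otimes> (s \<otimes> a'))"
      unfolding y_def using w bt carr by (simp add: m_ac)
    also have "\<dots> = (w \<otimes> s') \<otimes> (x \<otimes> (t \<otimes> a))"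
      unfolding eq[symmetric] using w bt carr by (simp add: m_ac)
    also have "\<dots> = y \<otimes> (s' \<otimes> b)"
      unfolding x y_def using w bt carr by (simp add: m_ac)
    finally show "(b, t) \<in> loc_frac R P a' s'"
      using y bt by (auto simp: loc_frac_def)
  qed
  show ?thesis
  proof
    show "loc_frac R P a s \<subseteq> loc_frac R P a' s'"
      using assms(3-6) eq by (rule sub)
    show "loc_frac R P a' s' \<subseteq> loc_frac R P a s"
      using assms(4,3,6,5) eq[symmetric] by (rule sub)
  qed
qed

lemma loc_frac_self:
  assumes "P \<in> Spec R" "a \<in> carrier R" "s \<in> carrier R - P"
  shows "(a, s) \<in> loc_frac R P a s"
  using assms unfolding loc_frac_def by (intro CollectI) (auto intro!: bexI[of _ s])

lemma ideal_sheaf_localE: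
  assumes "s \<in> ideal_sheaf R J U" "P \<in> U"
  obtains V a h where "openin (zariski R) V" "P \<in> V" "V \<subseteq> U" "a \<in> J" "h \<in> carrier R"
    "\<forall>Q\<in>V. h \<notin> Q \<and> s Q = loc_frac R Q a h"
proof -
  have "\<forall>P \<in> U. \<exists>V. openin (zariski R) V \<and> P \<in> V \<and> V \<subseteq> U \<and>
        (\<exists>a \<in> J. \<exists>h \<in> carrier R. \<forall>Q \<in> V. h \<notin> Q \<and> s Q = loc_frac R Q a h)"
    using assms(1) by (simp add: ideal_sheaf_def)
  from bspec[OF this assms(2)] obtain V a h where *: "openin (zariski R) V" "P \<in> V" "V \<subseteq> U"
      "a \<in> J" "h \<in> carrier R" "\<forall>Q \<in> V. h \<notin> Q \<and> s Q = loc_frac R Q a h"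
    by (elim exE conjE bexE)
  show thesis by (rule that[OF *])
qed

context ring_hom_cring
begin

lemma mem_Spec_map: "x \<in> Spec_map R h Q \<longleftrightarrow> x \<in> carrier R \<and> h x \<in> Q"
  by (simp add: Spec_map_def)

lemma mem_kernel: "x \<in> a_kernel R S h \<longleftrightarrow> x \<in> carrier R \<and> h x = \<zero>\<^bsub>S\<^esub>"
  unfolding a_kernel_def' by blast

lemma Spec_map_in_Spec:
  assumes "Q \<in> Spec S" shows "Spec_map R h Q \<in> Spec R"
proof -
  have "primeideal Q S" using assms by (simp add: Spec_def)
  then have "primeideal {r \<in> carrier R. h r \<in> Q} R"
    by (rule ring.primeideal_vimage[OF R.is_cring])
  then show ?thesis by (simp add: Spec_def Spec_map_def)
qed

text \<open>
  The union in \<^const>\<open>Spec_sheaf_map\<close> is one fraction, since all representatives of \<open>a/s\<close> have the same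
  image.
\<close>

lemma Spec_sheaf_map_loc_frac:
  assumes Q: "Q \<in> Spec S" and a: "a \<in> carrier R" and s: "s \<in> carrier R" "h s \<notin> Q"
  shows "(\<Union>(b, t) \<in> loc_frac R (Spec_map R h Q) a s. loc_frac S Q (h b) (h t)) = loc_frac S Q (h a) (h s)"
proof -
  have "loc_frac S Q (h b) (h t) = loc_frac S Q (h a) (h s)"
    if bt: "(b, t) \<in> loc_frac R (Spec_map R h Q) a s" for b t
  proof -
    obtain w where w: "b \<in> carrier R" "t \<in> carrier R" "h t \<notin> Q" "w \<in> carrier R" "h w \<notin> Q"
      "w \<otimes> (t \<otimes> a) = w \<otimes> (s \<otimes> b)"
      using bt by (auto simp: loc_frac_def mem_Spec_map)
    have "h (w \<otimes> (t \<otimes> a)) = h (w \<otimes> (s \<otimes> b))" using w(6) by simp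
    then have eq: "h w \<otimes>\<^bsub>S\<^esub> (h s \<otimes>\<^bsub>S\<^esub> h b) = h w \<otimes>\<^bsub>S\<^esub> (h t \<otimes>\<^bsub>S\<^esub> h a)"
      using w(1-5) a s by simp
    show ?thesis
      by (rule loc_frac_eqI[OF S.is_cring Q _ _ _ _ _ eq]) (use w(1-5) a s in simp_all)
  qed
  moreover have "(a, s) \<in> loc_frac R (Spec_map R h Q) a s"
    using a s by (intro loc_frac_self Spec_map_in_Spec[OF Q]) (simp_all add: mem_Spec_map)
  ultimately show ?thesis by fast
qed

lemma inj_on_Spec_map:
  assumes "h ` carrier R = carrier S"
  shows "inj_on (Spec_map R h) (Spec S)"
proof (rule inj_onI)
  have *: "Q = h ` Spec_map R h Q" if "Q \<in> Spec S" for Q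
  proof -
    show ?thesis
    proof (intro equalityI subsetI)
      fix y assume y: "y \<in> Q"
      then have "y \<in> h ` carrier R" using assms Spec_subset[OF that] by blast
      then show "y \<in> h ` Spec_map R h Q" using y by (auto simp: Spec_map_def)
    qed (auto simp: Spec_map_def)
  qed
  fix Q Q' assume "Q \<in> Spec S" "Q' \<in> Spec S" "Spec_map R h Q = Spec_map R h Q'"
  then show "Q = Q'" using * by metis
qed

text \<open>
  If \<open>P\<close> contains the kernel, it is saturated: \<open>h x\<close> lies in \<open>h ` P\<close> only for \<open>x \<in> P\<close>.  So the image of
  \<open>P\<close> is a prime ideal with preimage \<open>P\<close>.
\<close>

lemma Spec_map_onto:
  assumes surj: "h ` carrier R = carrier S"
    and P: "P \<in> Spec R" and ker: "a_kernel R S h \<subseteq> P"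
  obtains Q where "Q \<in> Spec S" "Spec_map R h Q = P"
proof
  note P_sub = Spec_subset[OF P]
  have mem: "h x \<in> h ` P \<longleftrightarrow> x \<in> P" if x: "x \<in> carrier R" for x
  proof
    assume "h x \<in> h ` P"
    then obtain y where y: "y \<in> P" "h x = h y" by auto
    then have yc: "y \<in> carrier R" using P_sub by blast
    have "h (x \<ominus> y) = h x \<oplus>\<^bsub>S\<^esub> \<ominus>\<^bsub>S\<^esub> h y" using x yc by (simp add: R.minus_eq)
    then have "h (x \<ominus> y) = \<zero>\<^bsub>S\<^esub>" using y(2)[symmetric] S.r_neg[OF hom_closed[OF x]] by metis
    then have "x \<ominus> y \<in> a_kernel R S h" using mem_kernel R.minus_closed[OF x yc] by blast
    then have "x \<ominus> y \<in> P" using ker by auto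
    then have "(x \<ominus> y) \<oplus> y \<in> P" using y by (simp add: Spec_add[OF P])
    moreover have "(x \<ominus> y) \<oplus> y = x" using x yc by (simp add: R.minus_eq R.a_assoc R.l_neg)
    ultimately show "x \<in> P" by simp
  qed auto
  show "Spec_map R h (h ` P) = P"
    using mem P_sub unfolding Spec_map_def by blast
  have ideal: "ideal (h ` P) S"
  proof (rule idealI)
    show "ring S" ..
    show "subgroup (h ` P) (add_monoid S)"
    proof (rule group.subgroupI)
      show "Group.group (add_monoid S)" by (rule S.a_group)
      show "h ` P \<subseteq> carrier (add_monoid S)" using P_sub by auto
      show "h ` P \<noteq> {}" using Spec_zero[OF P] by blast
      fix x assume "x \<in> h ` P"
      then obtain a where a: "a \<in> P" "x = h a" by auto
      then have "a \<in> carrier R" using P_sub by blast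
      then have "inv\<^bsub>add_monoid S\<^esub> x = h (\<ominus> a)" using a by (simp add: a_inv_def[symmetric])
      then show "inv\<^bsub>add_monoid S\<^esub> x \<in> h ` P" using Spec_a_inv[OF P a(1)] by (metis imageI)
    next
      fix x y assume "x \<in> h ` P" "y \<in> h ` P"
      then obtain a b where "a \<in> P" "b \<in> P" "x = h a" "y = h b" by auto
      then have "x \<oplus>\<^bsub>S\<^esub> y = h (a \<oplus> b)" "a \<oplus> b \<in> P"
        using P_sub Spec_add[OF P] by (auto simp: subset_iff)
      then show "x \<otimes>\<^bsub>add_monoid S\<^esub> y \<in> h ` P" by (simp only: monoid.simps imageI)
    qed
    fix a x assume "a \<in> h ` P" "x \<in> carrier S"
    then obtain b y where b: "b \<in> P" "y \<in> carrier R" "a = h b" "x = h y" using surj by blast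
    then have bc: "b \<in> carrier R" using P_sub by blast
    then have "x \<otimes>\<^bsub>S\<^esub> a = h (y \<otimes> b)" "a \<otimes>\<^bsub>S\<^esub> x = h (b \<otimes> y)" using b by auto
    then show "x \<otimes>\<^bsub>S\<^esub> a \<in> h ` P" "a \<otimes>\<^bsub>S\<^esub> x \<in> h ` P"
      using Spec_mult[OF P b(1,2)] R.m_comm[OF bc b(2)] by (metis imageI)+
  qed
  have "primeideal (h ` P) S"
  proof (rule primeidealI[OF ideal S.is_cring])
    have "\<one> \<notin> P" by (rule Spec_one[OF P])
    then show "carrier S \<noteq> h ` P" using mem[of \<one>] by (metis R.one_closed hom_closed)
    fix a b assume "a \<in> carrier S" "b \<in> carrier S" and ab: "a \<otimes>\<^bsub>S\<^esub> b \<in> h ` P"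
    then obtain x y where x: "x \<in> carrier R" "y \<in> carrier R" "a = h x" "b = h y" using surj by blast
    then have "h (x \<otimes> y) \<in> h ` P" using ab by simp
    then have "x \<otimes> y \<in> P" using mem[of "x \<otimes> y"] x by simp
    then show "a \<in> h ` P \<or> b \<in> h ` P" using Spec_prime[OF P] x by blast
  qed
  then show "h ` P \<in> Spec S" by (simp add: Spec_def)
qed

lemma continuous_map_Spec: "continuous_map (zariski S) (zariski R) (Spec_map R h)"
  unfolding continuous_map_def topspace_zariski
proof (intro conjI allI impI)
  show "Spec_map R h \<in> Spec S \<rightarrow> Spec R" using Spec_map_in_Spec by auto
  fix U assume "openin (zariski R) U"
  then obtain T where T: "T \<subseteq> carrier R" "U = {P \<in> Spec R. \<not> T \<subseteq> P}"
    by (auto simp: openin_zariski)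
  have "Spec_map R h Q \<in> U \<longleftrightarrow> \<not> h ` T \<subseteq> Q" if "Q \<in> Spec S" for Q
    using T(1) Spec_map_in_Spec[OF that] unfolding T(2) Spec_map_def by blast
  then have "{Q \<in> Spec S. Spec_map R h Q \<in> U} = {Q \<in> Spec S. \<not> h ` T \<subseteq> Q}"
    by (intro Collect_cong) blast
  then show "openin (zariski S) {Q \<in> Spec S. Spec_map R h Q \<in> U}"
    unfolding openin_zariski using T by (intro exI[of _ "h ` T"]) auto
qed

text \<open>
  The closed set \<open>V(T)\<close> has as image the closed set of the preimage of \<open>T\<close>.  Adding \<open>0\<close> to \<open>T\<close> puts
  the kernel into the preimage, so that all primes in this closed set come from \<open>S\<close>.
\<close>

lemma closed_map_Spec:
  assumes surj: "h ` carrier R = carrier S"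
  shows "closed_map (zariski S) (zariski R) (Spec_map R h)"
  unfolding closed_map_def
proof (intro allI impI)
  fix F assume "closedin (zariski S) F"
  then obtain T where T: "T \<subseteq> carrier S" "F = {Q \<in> Spec S. T \<subseteq> Q}"
    by (auto simp: closedin_zariski)
  define T' where "T' = {x \<in> carrier R. h x \<in> insert \<zero>\<^bsub>S\<^esub> T}"
  have "Spec_map R h ` F = {P \<in> Spec R. T' \<subseteq> P}"
  proof (intro equalityI subsetI)
    fix P assume "P \<in> Spec_map R h ` F"
    then obtain Q where Q: "Q \<in> Spec S" "T \<subseteq> Q" "P = Spec_map R h Q" using T by auto
    have "\<zero>\<^bsub>S\<^esub> \<in> Q" by (rule Spec_zero[OF Q(1)])
    then show "P \<in> {P \<in> Spec R. T' \<subseteq> P}"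
      using Q Spec_map_in_Spec unfolding T'_def by (auto simp: mem_Spec_map)
  next
    fix P assume P: "P \<in> {P \<in> Spec R. T' \<subseteq> P}"
    then have "a_kernel R S h \<subseteq> P" unfolding T'_def by (auto simp: mem_kernel)
    moreover have PS: "P \<in> Spec R" using P by simp
    ultimately obtain Q where Q: "Q \<in> Spec S" "Spec_map R h Q = P"
      by (meson Spec_map_onto[OF surj])
    have "T \<subseteq> Q"
    proof
      fix y assume y: "y \<in> T"
      then obtain x where x: "x \<in> carrier R" "y = h x" using T surj by auto
      then have "x \<in> P" using y P unfolding T'_def by auto
      then show "y \<in> Q" using x Q mem_Spec_map by auto
    qed
    then show "P \<in> Spec_map R h ` F" using Q T by auto
  qed
  then show "closedin (zariski R) (Spec_map R h ` F)"
    unfolding closedin_zariski by (intro exI[of _ T']) (auto simp: T'_def)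
qed

lemma zero_section_mem:
  assumes "openin (zariski R) V" shows "zero_section R V \<in> structure_sheaf R V"
proof -
  have "V \<subseteq> Spec R" using assms by (auto simp: openin_zariski)
  then have "\<one> \<notin> P" if "P \<in> V" for P
    using that Spec_one by blast
  then show ?thesis
    unfolding structure_sheaf_def ideal_sheaf_def zero_section_def
    using assms by (intro CollectI conjI ballI exI[of _ V] bexI[of _ \<zero>] bexI[of _ \<one>]) auto
qed

text \<open>
  A fraction on a neighbourhood in \<open>Spec S\<close> lifts by lifting numerator and denominator.  Away from the
  closed image of \<open>Spec S\<close> there is nothing to lift.
\<close>

lemma Spec_sheaf_map_locally_surj:
  assumes surj: "h ` carrier R = carrier S"
    and U: "openin (zariski R) U" and P: "P \<in> U"
    and t: "t \<in> structure_sheaf S (Spec_preimage R S h U)"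
  shows "\<exists>V. openin (zariski R) V \<and> P \<in> V \<and> V \<subseteq> U \<and>
           (\<exists>s \<in> structure_sheaf R V. Spec_sheaf_map R S h V s = restrict t (Spec_preimage R S h V))"
proof (cases "a_kernel R S h \<subseteq> P")
  case True
  have "P \<in> Spec R" using U P by (auto simp: openin_zariski)
  then obtain Q where Q: "Q \<in> Spec S" "Spec_map R h Q = P" by (rule Spec_map_onto[OF surj _ True])
  then have QU: "Q \<in> Spec_preimage R S h U" using P by (simp add: Spec_preimage_def)
  obtain W b g where W: "openin (zariski S) W" "Q \<in> W" "W \<subseteq> Spec_preimage R S h U"
      and bg: "b \<in> carrier S" "g \<in> carrier S"
      and fr: "\<forall>Q\<in>W. g \<notin> Q \<and> t Q = loc_frac S Q b g"
    by (rule ideal_sheaf_localE[OF t[unfolded structure_sheaf_def] QU])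
  obtain T where T: "T \<subseteq> carrier S" "W = {Q \<in> Spec S. \<not> T \<subseteq> Q}"
    using W(1) by (auto simp: openin_zariski)
  have "b \<in> h ` carrier R" "g \<in> h ` carrier R" using surj bg by simp_all
  then obtain a k where ak: "a \<in> carrier R" "k \<in> carrier R" "h a = b" "h k = g"
    by (elim imageE) simp
  define T' where "T' = {x \<in> carrier R. h x \<in> T}"
  have hT': "h ` T' = T"
  proof (intro equalityI subsetI)
    fix y assume y: "y \<in> T"
    then have "y \<in> h ` carrier R" using T(1) surj by auto
    then show "y \<in> h ` T'" using y by (elim imageE) (simp add: T'_def)
  qed (auto simp: T'_def)
  define V where "V = {P \<in> Spec R. \<not> T' \<subseteq> P} \<inter> {P \<in> Spec R. k \<notin> P} \<inter> U"
  have V: "openin (zariski R) V"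
    unfolding V_def
  proof (intro openin_Int U openin_basic ak(2))
    show "openin (zariski R) {P \<in> Spec R. \<not> T' \<subseteq> P}"
      unfolding openin_zariski by (intro exI[of _ T']) (auto simp: T'_def)
  qed
  have pre: "Q' \<in> W" if "Q' \<in> Spec S" "Spec_map R h Q' \<in> V" for Q'
  proof -
    have "\<not> T' \<subseteq> Spec_map R h Q'" using that(2) by (simp add: V_def)
    then have "\<not> h ` T' \<subseteq> Q'" unfolding Spec_map_def T'_def by blast
    then show ?thesis using that(1) T(2) hT' by simp
  qed
  have PV: "P \<in> V"
  proof -
    have "\<not> T' \<subseteq> P" using hT' W(2) Q T by (auto simp: mem_Spec_map)
    moreover have "k \<notin> P" using bspec[OF fr, OF W(2)] ak Q by (auto simp: mem_Spec_map)
    ultimately show ?thesis using \<open>P \<in> Spec R\<close> P by (simp add: V_def)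
  qed
  define s where "s = restrict (\<lambda>P. loc_frac R P a k) V"
  have "s \<in> structure_sheaf R V"
    unfolding structure_sheaf_def ideal_sheaf_def
    using V ak
    by (intro CollectI conjI ballI exI[of _ V] bexI[of _ a] bexI[of _ k]) (simp_all add: s_def, simp add: V_def)
  moreover have "Spec_sheaf_map R S h V s = restrict t (Spec_preimage R S h V)"
    unfolding Spec_sheaf_map_def
  proof (rule restrict_ext)
    fix Q' assume "Q' \<in> Spec_preimage R S h V"
    then have Q': "Q' \<in> Spec S" "Spec_map R h Q' \<in> V" by (auto simp: Spec_preimage_def)
    from bspec[OF fr, OF pre[OF this]] have f: "g \<notin> Q'" "t Q' = loc_frac S Q' b g" by auto
    show "(\<Union>(a, t)\<in>s (Spec_map R h Q'). loc_frac S Q' (h a) (h t)) = t Q'"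
      using Spec_sheaf_map_loc_frac[OF Q'(1) ak(1,2)] Q' f ak by (simp add: s_def)
  qed
  ultimately show ?thesis using V PV by (intro exI[of _ V]) (auto simp: V_def)
next
  case False
  define V where "V = {P \<in> Spec R. \<not> a_kernel R S h \<subseteq> P} \<inter> U"
  have V: "openin (zariski R) V"
    unfolding V_def
  proof (intro openin_Int U)
    show "openin (zariski R) {P \<in> Spec R. \<not> a_kernel R S h \<subseteq> P}"
      unfolding openin_zariski by (intro exI[of _ "a_kernel R S h"]) (auto simp: mem_kernel)
  qed
  have "Spec_preimage R S h V = {}"
  proof -
    have "a_kernel R S h \<subseteq> Spec_map R h Q" if "Q \<in> Spec S" for Q
      using Spec_zero[OF that] by (auto simp: mem_kernel mem_Spec_map)
    then show ?thesis by (auto simp: Spec_preimage_def V_def)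
  qed
  then have "Spec_sheaf_map R S h V (zero_section R V) = restrict t (Spec_preimage R S h V)"
    by (simp add: Spec_sheaf_map_def restrict_def)
  moreover have "P \<in> V" using P False U by (auto simp: V_def openin_zariski)
  ultimately show ?thesis using V zero_section_mem[OF V] by (intro exI[of _ V]) (auto simp: V_def)
qed

text \<open>
  If \<open>a/k\<close> becomes \<open>0\<close> in the localization of \<open>S\<close> at \<open>Q\<close>, then \<open>w a\<close> lies in the kernel for some \<open>w\<close> outside
  the preimage of \<open>Q\<close>, and \<open>a/k = wa/wk\<close> has a numerator in the kernel.  At a prime that does not
  contain the kernel, any \<open>w\<close> in the kernel but not in the prime does the same.
\<close>

lemma kernel_Spec_sheaf_map:
  assumes surj: "h ` carrier R = carrier S" and U: "openin (zariski R) U"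
  shows "{s \<in> structure_sheaf R U. Spec_sheaf_map R S h U s = zero_section S (Spec_preimage R S h U)}
           = ideal_sheaf R (a_kernel R S h) U"
proof (intro equalityI subsetI)
  fix s assume s: "s \<in> ideal_sheaf R (a_kernel R S h) U"
  have "s \<in> structure_sheaf R U"
    unfolding structure_sheaf_def ideal_sheaf_def
  proof (intro CollectI conjI ballI)
    show "s \<in> extensional U" using s by (simp add: ideal_sheaf_def)
    fix P assume "P \<in> U"
    with s obtain V a k where V: "openin (zariski R) V" "P \<in> V" "V \<subseteq> U"
      and ak: "a \<in> a_kernel R S h" "k \<in> carrier R"
      and fr: "\<forall>Q\<in>V. k \<notin> Q \<and> s Q = loc_frac R Q a k"
      by (rule ideal_sheaf_localE)
    from ak(1) have "a \<in> carrier R" by (simp add: mem_kernel)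
    with V ak(2) fr show "\<exists>V. openin (zariski R) V \<and> P \<in> V \<and> V \<subseteq> U \<and>
        (\<exists>a\<in>carrier R. \<exists>h\<in>carrier R. \<forall>Q\<in>V. h \<notin> Q \<and> s Q = loc_frac R Q a h)"
      by (intro exI[of _ V] conjI bexI[of _ a] bexI[of _ k])
  qed
  moreover have "Spec_sheaf_map R S h U s = zero_section S (Spec_preimage R S h U)"
    unfolding Spec_sheaf_map_def zero_section_def
  proof (rule restrict_ext)
    fix Q assume "Q \<in> Spec_preimage R S h U"
    then have Q: "Q \<in> Spec S" "Spec_map R h Q \<in> U" by (auto simp: Spec_preimage_def)
    from s Q(2) obtain V a k where V: "openin (zariski R) V" "Spec_map R h Q \<in> V" "V \<subseteq> U"
      and ak: "a \<in> a_kernel R S h" "k \<in> carrier R"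
      and fr: "\<forall>Q\<in>V. k \<notin> Q \<and> s Q = loc_frac R Q a k"
      by (rule ideal_sheaf_localE)
    have sQ: "s (Spec_map R h Q) = loc_frac R (Spec_map R h Q) a k" and "k \<notin> Spec_map R h Q"
      using bspec[OF fr, OF V(2)] by simp_all
    with ak have a: "a \<in> carrier R" "h a = \<zero>\<^bsub>S\<^esub>" and k: "h k \<notin> Q"
      by (auto simp: mem_kernel mem_Spec_map)
    have one: "\<one>\<^bsub>S\<^esub> \<notin> Q" by (rule Spec_one[OF Q(1)])
    have "(\<Union>(a, t)\<in>s (Spec_map R h Q). loc_frac S Q (h a) (h t)) = loc_frac S Q (h a) (h k)"
      unfolding sQ by (rule Spec_sheaf_map_loc_frac[OF Q(1) a(1) ak(2) k])
    also have "\<dots> = loc_frac S Q \<zero>\<^bsub>S\<^esub> \<one>\<^bsub>S\<^esub>"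
      by (rule loc_frac_eqI[OF S.is_cring Q(1), where w = "\<one>\<^bsub>S\<^esub>"]) (use a k ak(2) one Q(1) in simp_all)
    finally show "(\<Union>(a, t)\<in>s (Spec_map R h Q). loc_frac S Q (h a) (h t)) = loc_frac S Q \<zero>\<^bsub>S\<^esub> \<one>\<^bsub>S\<^esub>" .
  qed
  ultimately show "s \<in> {s \<in> structure_sheaf R U.
      Spec_sheaf_map R S h U s = zero_section S (Spec_preimage R S h U)}" by simp
next
  fix s assume "s \<in> {s \<in> structure_sheaf R U.
      Spec_sheaf_map R S h U s = zero_section S (Spec_preimage R S h U)}"
  then have s: "s \<in> structure_sheaf R U"
    and zero: "Spec_sheaf_map R S h U s = zero_section S (Spec_preimage R S h U)" by auto
  have "\<exists>V. openin (zariski R) V \<and> P \<in> V \<and> V \<subseteq> U \<and>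
        (\<exists>a \<in> a_kernel R S h. \<exists>k \<in> carrier R. \<forall>Q \<in> V. k \<notin> Q \<and> s Q = loc_frac R Q a k)"
    if P: "P \<in> U" for P
  proof -
    obtain V a k where V: "openin (zariski R) V" "P \<in> V" "V \<subseteq> U" and ak: "a \<in> carrier R" "k \<in> carrier R"
      and fr: "\<forall>Q\<in>V. k \<notin> Q \<and> s Q = loc_frac R Q a k"
      by (rule ideal_sheaf_localE[OF s[unfolded structure_sheaf_def] P])
    have PS: "P \<in> Spec R" using U P by (auto simp: openin_zariski)
    have "\<exists>w \<in> carrier R. w \<notin> P \<and> h (w \<otimes> a) = \<zero>\<^bsub>S\<^esub>"
    proof (cases "a_kernel R S h \<subseteq> P")
      case True
      obtain Q where Q: "Q \<in> Spec S" "Spec_map R h Q = P" by (rule Spec_map_onto[OF surj PS True])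
      have QU: "Q \<in> Spec_preimage R S h U" using Q P by (simp add: Spec_preimage_def)
      have k: "h k \<notin> Q" using bspec[OF fr, OF V(2)] Q ak by (auto simp: mem_Spec_map)
      have "loc_frac S Q (h a) (h k) = Spec_sheaf_map R S h U s Q"
        using QU Q bspec[OF fr, OF V(2)] Spec_sheaf_map_loc_frac[OF Q(1) ak k] by (simp add: Spec_sheaf_map_def)
      also have "\<dots> = loc_frac S Q \<zero>\<^bsub>S\<^esub> \<one>\<^bsub>S\<^esub>"
        using QU by (simp add: zero zero_section_def)
      finally have "(h a, h k) \<in> loc_frac S Q \<zero>\<^bsub>S\<^esub> \<one>\<^bsub>S\<^esub>"
        using loc_frac_self[OF Q(1), of "h a" "h k"] ak k by auto
      then obtain x where x: "x \<in> carrier S" "x \<notin> Q" "\<zero>\<^bsub>S\<^esub> = x \<otimes>\<^bsub>S\<^esub> h a"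
        using ak by (auto simp: loc_frac_def)
      then obtain w where w: "w \<in> carrier R" "x = h w" using surj by auto
      then show ?thesis using x Q ak by (intro bexI[of _ w]) (auto simp: mem_Spec_map)
    next
      case False
      then obtain w where "w \<in> a_kernel R S h" "w \<notin> P" by auto
      then show ?thesis using ak by (intro bexI[of _ w]) (auto simp: mem_kernel)
    qed
    then obtain w where w: "w \<in> carrier R" "w \<notin> P" "h (w \<otimes> a) = \<zero>\<^bsub>S\<^esub>" by blast
    define V' where "V' = V \<inter> {P \<in> Spec R. w \<notin> P}"
    have V': "openin (zariski R) V'" unfolding V'_def using V w openin_basic by (intro openin_Int) auto
    have "w \<otimes> k \<notin> Q \<and> s Q = loc_frac R Q (w \<otimes> a) (w \<otimes> k)" if "Q \<in> V'" for Q
    proof -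
      have Q: "Q \<in> V" "Q \<in> Spec R" "w \<notin> Q" using that by (auto simp: V'_def)
      have k: "k \<notin> Q" "s Q = loc_frac R Q a k" using bspec[OF fr, OF Q(1)] by auto
      then have wk: "w \<otimes> k \<notin> Q" using Q(3) w(1) ak(2) Spec_prime[OF Q(2)] by blast
      have "loc_frac R Q a k = loc_frac R Q (w \<otimes> a) (w \<otimes> k)"
        by (rule loc_frac_eqI[OF R.is_cring Q(2), where w = w])
          (use w(1) ak k(1) wk Q(3) in \<open>simp_all add: R.m_ac\<close>)
      then show ?thesis using wk k by simp
    qed
    moreover have "w \<otimes> a \<in> a_kernel R S h" using w ak by (simp add: mem_kernel)
    moreover have "w \<otimes> k \<in> carrier R" using w ak by simp
    moreover have "P \<in> V'" "V' \<subseteq> U" using V PS w by (auto simp: V'_def)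
    ultimately show ?thesis using V'
      by (intro exI[of _ V'] conjI bexI[of _ "w \<otimes> a"] bexI[of _ "w \<otimes> k"]) auto
  qed
  then show "s \<in> ideal_sheaf R (a_kernel R S h) U"
    using s unfolding structure_sheaf_def ideal_sheaf_def by (intro CollectI conjI ballI) auto
qed

lemma closed_embedding_of_surjection:
  assumes "h ` carrier R = carrier S"
  shows "closed_embedding_with_ideal R S h (a_kernel R S h)"
  unfolding closed_embedding_with_ideal_def
proof (intro conjI)
  show "ring_hom_cring R S h" ..
  show "ideal (a_kernel R S h) R" by (rule ring.kernel_is_ideal)
  show "embedding_map (zariski S) (zariski R) (Spec_map R h)"
    using inj_on_Spec_map[OF assms] closed_map_Spec[OF assms] continuous_map_Spec
    by (intro injective_closed_imp_embedding_map) (auto simp: topspace_zariski)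
qed (use closed_map_Spec Spec_sheaf_map_locally_surj kernel_Spec_sheaf_map assms in blast)+

end

section \<open>The embedding of \<open>X(L)\<close> in \<open>X(C)\<close>\<close>

lemma ring_on_simps [simp]:
  "carrier (ring_on S) = S" "mult (ring_on S) = (*)" "one (ring_on S) = 1"
  "zero (ring_on S) = 0" "add (ring_on S) = (+)"
  by (simp_all add: ring_on_def)

lemma cring_ring_on:
  assumes "1 \<in> S" "\<And>x y. x \<in> S \<Longrightarrow> y \<in> S \<Longrightarrow> x + y \<in> S" "\<And>x y. x \<in> S \<Longrightarrow> y \<in> S \<Longrightarrow> x * y \<in> S"
    "\<And>x. x \<in> S \<Longrightarrow> - x \<in> S"
  shows "cring (ring_on S)"
proof (rule cringI)
  have "0 \<in> S" using assms(2)[OF assms(1) assms(4)[OF assms(1)]] by simp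
  then show "abelian_group (ring_on S)"
  proof (intro abelian_groupI)
    fix x assume "x \<in> carrier (ring_on S)"
    then show "\<exists>y\<in>carrier (ring_on S). y \<oplus>\<^bsub>ring_on S\<^esub> x = \<zero>\<^bsub>ring_on S\<^esub>"
      using assms(4)[of x] by (intro bexI[of _ "- x"]) simp_all
  qed (simp_all add: assms(2) add_ac)
  show "comm_monoid (ring_on S)"
    by (intro comm_monoidI) (simp_all add: assms(1,3) mult_ac)
qed (simp add: distrib_right)

lemma lookup_scale_C: "Poly_Mapping.lookup (scale_C c f) k = c * Poly_Mapping.lookup f k"
  by (simp add: scale_C_def map.rep_eq when_def)

lemma lookup_scale_L: "Poly_Mapping.lookup (scale_L c f) k = const_fract c * Poly_Mapping.lookup f k"
  by (simp add: scale_L_def map.rep_eq when_def)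

lemma vector_space_scale_C: "vector_space (scale_C :: 'k::field \<Rightarrow> ('a \<Rightarrow>\<^sub>0 'k) \<Rightarrow> _)"
  by unfold_locales (simp_all add: poly_mapping_eq_iff fun_eq_iff lookup_scale_C lookup_add algebra_simps)

lemma vector_space_scale_L: "vector_space (scale_L :: 'k::field \<Rightarrow> ('a \<Rightarrow>\<^sub>0 'k poly fract) \<Rightarrow> _)"
  by unfold_locales (simp_all add: poly_mapping_eq_iff fun_eq_iff lookup_scale_L lookup_add
      const_fract_add const_fract_mult algebra_simps)

lemma degree_part_C_closed:
  "f \<in> degree_part_C u \<Longrightarrow> g \<in> degree_part_C u \<Longrightarrow> f + g \<in> degree_part_C u"
  "f \<in> degree_part_C u \<Longrightarrow> scale_C c f \<in> degree_part_C u"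
  "0 \<in> degree_part_C u"
  using Poly_Mapping.keys_add[of f g]
  by (auto simp: degree_part_C_def in_keys_iff lookup_scale_C image_subset_iff)

locale line_in_cone = torus_line p q
  for p q :: "'k::alg_closed_field ^ ('m::finite option)" +
  fixes \<sigma> :: "('u::ab_group_add \<Rightarrow> rat) set" and \<Delta> :: "'m option \<Rightarrow> ('u \<Rightarrow> rat) set"
  assumes cone: "polyhedral_cone \<sigma>"
    and polyhedra: "\<And>i. \<Delta> i = {} \<or> (rat_polyhedron (\<Delta> i) \<and> tailcone (\<Delta> i) = \<sigma>)"
begin

abbreviation AC :: "('u \<times> (int ^ 'm) \<Rightarrow>\<^sub>0 'k) set" where "AC \<equiv> A_C \<sigma> \<Delta>"
abbreviation AL :: "('u \<Rightarrow>\<^sub>0 'k poly fract) set" where "AL \<equiv> A_L \<sigma> \<Delta> p q"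
abbreviation IL :: "('u \<times> (int ^ 'm) \<Rightarrow>\<^sub>0 'k) set" where "IL \<equiv> ideal_tilde \<sigma> \<Delta> p q"

definition floor_min :: "'u \<Rightarrow> 'm option \<Rightarrow> int extended" where
  "floor_min u i = map_extended floor (eval_min (\<Delta> i) u)"

lemma divisor_L_eq: "divisor_L \<Delta> p q u = (\<lambda>P. \<Sum>i | Q_point p q i = P. floor_min u i)"
  by (simp add: fun_eq_iff divisor_L_def floor_min_def)

lemma floor_min_not_Minf: "floor_min u i \<noteq> -\<infinity>"
  by (simp add: floor_min_def eval_min_def)

lemma dual_C_iff_floor_min:
  assumes "u \<in> dual_cone \<sigma>"
  shows "(u, v) \<in> dual_C (cone_C \<sigma> \<Delta>) \<longleftrightarrow> (\<forall>i. 0 \<le> floor_min u i + Fin (homog_exp v i))"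
  using assms nonneg_on_polyhedron_iff[OF polyhedra assms] by (simp add: dual_C_iff floor_min_def)

lemma dual_C_imp_dual_cone: "(u, v) \<in> dual_C (cone_C \<sigma> \<Delta>) \<Longrightarrow> u \<in> dual_cone \<sigma>"
  by (simp add: dual_C_iff)

lemma cochars: "\<sigma> \<subseteq> cochar_space" "\<Delta> i \<subseteq> cochar_space"
  using cone polyhedra[of i] by (auto simp: polyhedral_cone_def rat_polyhedron_def)

lemma zero_in_dual_C: "0 \<in> dual_C (cone_C \<sigma> \<Delta>)"
proof -
  have "a 0 = 0" if "a \<in> cochar_space" for a :: "'u \<Rightarrow> rat"
    using that additive.zero by (auto simp: cochar_space_def)
  moreover have "homog_exp 0 i = 0" for i :: "'m option" by (cases i) simp_all
  ultimately show ?thesis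
    using cochars by (force simp: zero_prod_def dual_C_iff dual_cone_def)
qed

text \<open>
  The lattice points of \<open>C\<^sup>\<or>\<close> form a semigroup because cocharacters are additive.
\<close>

lemma dual_C_add:
  assumes "x \<in> dual_C (cone_C \<sigma> \<Delta>)" "y \<in> dual_C (cone_C \<sigma> \<Delta>)"
  shows "x + y \<in> dual_C (cone_C \<sigma> \<Delta>)"
proof -
  obtain u v u' v' where xy: "x = (u, v)" "y = (u', v')" by (cases x, cases y)
  have add: "a (u + u') = a u + a u'" if "a \<in> cochar_space" for a
    using that additive.add by (auto simp: cochar_space_def)
  have "0 \<le> a (u + u')" if "a \<in> \<sigma>" for a
  proof -
    have "0 \<le> a u" "0 \<le> a u'" using assms that by (auto simp: xy dual_C_iff dual_cone_def)
    then show ?thesis using add[of a] cochars(1) that by auto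
  qed
  moreover have "0 \<le> a (u + u') + of_int (homog_exp (v + v') i)" if "a \<in> \<Delta> i" for a i
  proof -
    have "0 \<le> a u + of_int (homog_exp v i)" "0 \<le> a u' + of_int (homog_exp v' i)"
      using assms that by (auto simp: xy dual_C_iff)
    then show ?thesis using add[of a] cochars(2)[of i] that by (auto simp: homog_exp_add)
  qed
  ultimately show ?thesis by (simp add: xy dual_C_iff dual_cone_def)
qed

lemma A_C_1: "1 \<in> AC"
  using zero_in_dual_C by (simp add: A_C_def)

lemma A_C_0: "0 \<in> AC"
  by (simp add: A_C_def)

lemma A_C_add: "f \<in> AC \<Longrightarrow> g \<in> AC \<Longrightarrow> f + g \<in> AC"
  using Poly_Mapping.keys_add[of f g] by (auto simp: A_C_def)

lemma A_C_mult: "f \<in> AC \<Longrightarrow> g \<in> AC \<Longrightarrow> f * g \<in> AC"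
  using Poly_Mapping.keys_mult[of f g] dual_C_add by (fastforce simp: A_C_def)

lemma A_C_uminus: "f \<in> AC \<Longrightarrow> - f \<in> AC"
  by (auto simp: A_C_def in_keys_iff subset_iff)

lemma A_C_scale: "f \<in> AC \<Longrightarrow> scale_C c f \<in> AC"
  by (auto simp: A_C_def in_keys_iff subset_iff lookup_scale_C)

lemma A_C_sum: "(\<And>i. i \<in> I \<Longrightarrow> f i \<in> AC) \<Longrightarrow> (\<Sum>i\<in>I. f i) \<in> AC"
  by (induction I rule: infinite_finite_induct) (simp_all add: A_C_0 A_C_add)

lemma slice_in_A_C: "f \<in> AC \<Longrightarrow> times_chi (slice u f) u \<in> AC"
  by (auto simp: A_C_def in_keys_iff subset_iff lookup_times_chi split: if_splits)

section \<open>Surjectivity\<close>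

lemma restr_in_A_L:
  assumes f: "f \<in> AC" shows "restr p q f \<in> AL"
proof -
  have u: "u \<in> dual_cone \<sigma>" if "u \<in> Poly_Mapping.keys (restr p q f)" for u
  proof -
    have "restr_Laurent (slice u f) \<noteq> 0" using that by (simp add: in_keys_iff lookup_restr)
    then have "slice u f \<noteq> 0" by auto
    then obtain v where "Poly_Mapping.lookup (slice u f) v \<noteq> 0"
      by (metis lookup_zero poly_mapping_eqI)
    then have "(u, v) \<in> dual_C (cone_C \<sigma> \<Delta>)"
      using f by (auto simp: A_C_def in_keys_iff)
    then show ?thesis by (rule dual_C_imp_dual_cone)
  qed
  moreover have "Poly_Mapping.lookup (restr p q f) u \<in> global_sections (divisor_L \<Delta> p q u)"
    if "u \<in> dual_cone \<sigma>" for u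
    unfolding lookup_restr restr_Laurent_def divisor_L_eq
  proof (intro global_sections_sum zmon_global_section)
    fix v i assume "v \<in> Poly_Mapping.keys (slice u f)"
    then have "(u, v) \<in> dual_C (cone_C \<sigma> \<Delta>)" using f by (auto simp: A_C_def in_keys_iff)
    then show "0 \<le> floor_min u i + Fin (homog_exp v i)"
      using dual_C_iff_floor_min[OF that] by blast
  qed
  ultimately show ?thesis by (auto simp: A_L_def)
qed

lemma lift_homogeneous:
  assumes "u \<in> dual_cone \<sigma>" "f \<in> global_sections (divisor_L \<Delta> p q u)"
  obtains g where "times_chi g u \<in> AC" "restr p q (times_chi g u) = Poly_Mapping.single u f"
proof -
  obtain g where g: "restr_Laurent g = f"
      "\<And>v i. v \<in> Poly_Mapping.keys g \<Longrightarrow> 0 \<le> floor_min u i + Fin (homog_exp v i)"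
    by (rule lift_global_section[OF floor_min_not_Minf assms(2)[unfolded divisor_L_eq]]) blast
  have "times_chi g u \<in> AC"
    using g(2) dual_C_iff_floor_min[OF assms(1)] by (auto simp: A_C_def keys_times_chi)
  then show thesis using that g(1) restr_times_chi by metis
qed

lemma restr_image: "restr p q ` AC = AL"
proof (intro equalityI subsetI)
  fix F assume F: "F \<in> AL"
  have "\<exists>f. f \<in> AC \<and> restr p q f = Poly_Mapping.single u (Poly_Mapping.lookup F u)"
    if "u \<in> Poly_Mapping.keys F" for u
  proof -
    have "u \<in> dual_cone \<sigma>" "Poly_Mapping.lookup F u \<in> global_sections (divisor_L \<Delta> p q u)"
      using F that by (auto simp: A_L_def)
    then show ?thesis using lift_homogeneous by metis
  qed
  then obtain G where G: "\<And>u. u \<in> Poly_Mapping.keys F \<Longrightarrow>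
      G u \<in> AC \<and> restr p q (G u) = Poly_Mapping.single u (Poly_Mapping.lookup F u)"
    by metis
  have "restr p q (\<Sum>u\<in>Poly_Mapping.keys F. G u) = F"
    unfolding restr_sum using G by (subst (2) poly_mapping_sum_singles) (simp cong: sum.cong)
  then show "F \<in> restr p q ` AC" using G A_C_sum by (metis (no_types, lifting) imageI)
qed (use restr_in_A_L in auto)

lemma restr_image_degree:
  assumes "u \<in> dual_cone \<sigma>"
  shows "restr p q ` (AC \<inter> degree_part_C u) = AL \<inter> degree_part_L u"
proof (intro equalityI subsetI)
  fix F assume "F \<in> restr p q ` (AC \<inter> degree_part_C u)"
  then obtain f where f: "f \<in> AC" "f \<in> degree_part_C u" "F = restr p q f" by auto
  have "F = Poly_Mapping.single u (restr_Laurent (slice u f))"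
    using restr_times_chi[of "slice u f" u] times_chi_slice[OF f(2)] f(3) by simp
  then show "F \<in> AL \<inter> degree_part_L u"
    using restr_in_A_L[OF f(1)] f(3) by (simp add: degree_part_L_def)
next
  fix F assume F: "F \<in> AL \<inter> degree_part_L u"
  then have single: "F = Poly_Mapping.single u (Poly_Mapping.lookup F u)"
    by (intro poly_mapping_eqI) (auto simp: degree_part_L_def lookup_single when_def in_keys_iff)
  have "Poly_Mapping.lookup F u \<in> global_sections (divisor_L \<Delta> p q u)"
    using F by (cases "u \<in> Poly_Mapping.keys F") (auto simp: A_L_def in_keys_iff global_sections_def)
  with assms obtain g where "times_chi g u \<in> AC"
      "restr p q (times_chi g u) = Poly_Mapping.single u (Poly_Mapping.lookup F u)"
    by (rule lift_homogeneous)
  then have "times_chi g u \<in> AC" "restr p q (times_chi g u) = F" by (simp_all only: single[symmetric])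
  then show "F \<in> restr p q ` (AC \<inter> degree_part_C u)"
    by (intro image_eqI[of _ _ "times_chi g u"]) (simp_all add: times_chi_degree)
qed

section \<open>The kernel\<close>

lemma cring_A_C: "cring (ring_on AC)"
  by (intro cring_ring_on A_C_1 A_C_add A_C_mult A_C_uminus)

lemma restr_uminus: "restr p q (- f) = - restr p q f" for f :: "'u \<times> (int ^ 'm) \<Rightarrow>\<^sub>0 'k"
  using restr_add[of f "- f"] by (simp add: eq_neg_iff_add_eq_0 add.commute)

text \<open>
  Being the image of \<open>A(C)\<close> under a homomorphism, \<open>A(L)\<close> is a ring; in particular products of sections
  of the divisors for \<open>u\<close> and \<open>u'\<close> are sections of the divisor for \<open>u + u'\<close>.
\<close>

lemma cring_A_L: "cring (ring_on AL)"
proof (rule cring_ring_on)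
  show "1 \<in> AL" using restr_in_A_L[OF A_C_1] by (simp add: restr_one)
  fix x assume "x \<in> AL"
  then obtain f where f: "f \<in> AC" "x = restr p q f" unfolding restr_image[symmetric] by blast
  then show "- x \<in> AL" using restr_in_A_L[OF A_C_uminus[OF f(1)]] by (simp add: restr_uminus)
  fix y assume "y \<in> AL"
  then obtain g where g: "g \<in> AC" "y = restr p q g" unfolding restr_image[symmetric] by blast
  show "x + y \<in> AL" using restr_in_A_L[OF A_C_add[OF f(1) g(1)]] f g by (simp add: restr_add)
  show "x * y \<in> AL" using restr_in_A_L[OF A_C_mult[OF f(1) g(1)]] f g by (simp add: restr_mult)
qed

lemma ring_hom_restr: "ring_hom_cring (ring_on AC) (ring_on AL) (restr p q)"
proof (intro ring_hom_cringI ring_hom_ringI cring_A_C cring_A_L)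
  show "Ring.ring (ring_on AC)" "Ring.ring (ring_on AL)"
    using cring_A_C cring_A_L by (auto simp: cring_def)
qed (simp_all add: restr_in_A_L restr_add restr_mult restr_one)

lemma kernel_eq: "a_kernel (ring_on AC) (ring_on AL) (restr p q) = {f \<in> AC. restr p q f = 0}"
proof -
  interpret ring_hom_cring "ring_on AC" "ring_on AL" "restr p q" by (rule ring_hom_restr)
  show ?thesis unfolding mem_kernel set_eq_iff by simp
qed

text \<open>
  The restriction map respects the grading by \<open>M\<close>, so its kernel contains the homogeneous components
  of its elements.  A homogeneous element \<open>f \<cdot> \<chi>\<^sup>u\<close> is in the kernel if and only if \<open>f\<close> vanishes on
  \<open>L\<^sup>\<circ>\<close>, that is, if it is one of the generators of the ideal.
\<close>

lemma ideal_tilde_eq_kernel: "IL = {f \<in> AC. restr p q f = 0}"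
proof
  let ?G = "{times_chi f u |f u. f \<in> ideal_line p q \<and> times_chi f u \<in> AC}"
  interpret ring_hom_cring "ring_on AC" "ring_on AL" "restr p q" by (rule ring_hom_restr)
  have GC: "?G \<subseteq> carrier (ring_on AC)" by auto
  have "?G \<subseteq> a_kernel (ring_on AC) (ring_on AL) (restr p q)"
    unfolding kernel_eq by (auto simp: restr_times_chi restr_Laurent_eq_0_iff[symmetric])
  then show "IL \<subseteq> {f \<in> AC. restr p q f = 0}"
    unfolding ideal_tilde_def kernel_eq[symmetric]
    by (rule R.genideal_minimal[OF ring.kernel_is_ideal])
  have I: "ideal IL (ring_on AC)"
    unfolding ideal_tilde_def using GC by (rule R.genideal_ideal)
  have zero: "0 \<in> IL"
    using additive_subgroup.zero_closed[OF ideal.axioms(1)[OF I]] by simp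
  have add: "x + y \<in> IL" if "x \<in> IL" "y \<in> IL" for x y
    using additive_subgroup.a_closed[OF ideal.axioms(1)[OF I] that] by simp
  have sum: "(\<And>i. i \<in> S \<Longrightarrow> f i \<in> IL) \<Longrightarrow> (\<Sum>i\<in>S. f i) \<in> IL" for f and S :: "'u set"
    by (induction S rule: infinite_finite_induct) (simp_all add: zero add)
  show "{f \<in> AC. restr p q f = 0} \<subseteq> IL"
  proof
    fix f assume f: "f \<in> {f \<in> AC. restr p q f = 0}"
    have "times_chi (slice u f) u \<in> IL" for u
    proof -
      have "restr_Laurent (slice u f) = 0" using f lookup_restr[of f u] by simp
      then have "times_chi (slice u f) u \<in> ?G"
        using f slice_in_A_C by (auto simp: restr_Laurent_eq_0_iff)
      then show ?thesis
        unfolding ideal_tilde_def using R.genideal_self[OF GC] by blast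
    qed
    then have "(\<Sum>u\<in>fst ` Poly_Mapping.keys f. times_chi (slice u f) u) \<in> IL"
      by (intro sum)
    then show "f \<in> IL" using sum_times_chi_slice[of f] by simp
  qed
qed

lemma restr_scale: "restr p q (scale_C c f) = scale_L c (restr p q f)"
  for f :: "'u \<times> (int ^ 'm) \<Rightarrow>\<^sub>0 'k"
  unfolding scale_C_def scale_L_def mult_map_scale_conv_mult restr_mult restr_const ..

lemma short_exact_degree:
  assumes u: "u \<in> dual_cone \<sigma>"
  shows "short_exact scale_C scale_C scale_L (IL \<inter> degree_part_C u) (\<lambda>f. f)
    (AC \<inter> degree_part_C u) (restr p q) (AL \<inter> degree_part_L u)"
proof -
  interpret C: vector_space "scale_C :: 'k \<Rightarrow> ('u \<times> (int ^ 'm) \<Rightarrow>\<^sub>0 'k) \<Rightarrow> _"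
    by (rule vector_space_scale_C)
  interpret L: vector_space "scale_L :: 'k \<Rightarrow> ('u \<Rightarrow>\<^sub>0 'k poly fract) \<Rightarrow> _"
    by (rule vector_space_scale_L)
  have subC: "C.subspace (AC \<inter> degree_part_C u)"
    by (intro C.subspaceI) (auto simp: A_C_0 A_C_add A_C_scale degree_part_C_closed)
  have subI: "C.subspace (IL \<inter> degree_part_C u)"
    unfolding ideal_tilde_eq_kernel
    by (intro C.subspaceI)
      (auto simp: A_C_0 A_C_add A_C_scale degree_part_C_closed restr_add restr_scale)
  have "L.subspace (restr p q ` (AC \<inter> degree_part_C u))"
  proof (intro L.subspaceI)
    let ?W = "AC \<inter> degree_part_C u"
    show "0 \<in> restr p q ` ?W" using C.subspace_0[OF subC] restr_0 by (metis imageI)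
    fix x assume "x \<in> restr p q ` ?W"
    then obtain f where f: "f \<in> ?W" "x = restr p q f" by blast
    show "scale_L c x \<in> restr p q ` ?W" for c
      using C.subspace_scale[OF subC f(1)] f(2) restr_scale by (metis imageI)
    fix y assume "y \<in> restr p q ` ?W"
    then obtain g where "g \<in> ?W" "y = restr p q g" by blast
    then show "x + y \<in> restr p q ` ?W"
      using C.subspace_add[OF subC f(1)] f(2) restr_add by (metis imageI)
  qed
  then have subL: "L.subspace (AL \<inter> degree_part_L u)" unfolding restr_image_degree[OF u] .
  show ?thesis
    unfolding short_exact_def linear_between_def
  proof (intro conjI)
    show "restr p q \<in> AC \<inter> degree_part_C u \<rightarrow> AL \<inter> degree_part_L u"
      using restr_image_degree[OF u] by blast
    show "(\<lambda>f. f) ` (IL \<inter> degree_part_C u) = {x \<in> AC \<inter> degree_part_C u. restr p q x = 0}"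
      unfolding ideal_tilde_eq_kernel by auto
  qed (use subC subI subL vector_space_scale_C vector_space_scale_L restr_image_degree[OF u]
      in \<open>auto simp: restr_add restr_scale ideal_tilde_eq_kernel\<close>)
qed

lemma closed_embedding_restr:
  "closed_embedding_with_ideal (ring_on AC) (ring_on AL) (restr p q) IL"
proof -
  interpret ring_hom_cring "ring_on AC" "ring_on AL" "restr p q" by (rule ring_hom_restr)
  show ?thesis
    using closed_embedding_of_surjection restr_image unfolding ideal_tilde_eq_kernel kernel_eq by simp
qed

end

theorem theorem2p2:
  fixes \<sigma> :: "('u::ab_group_add \<Rightarrow> rat) set"
    and \<Delta> :: "'m::finite option \<Rightarrow> ('u \<Rightarrow> rat) set"
    and p q :: "'k::alg_closed_field ^ ('m option)"
  assumes "free_of_finite_rank TYPE('u)"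
    and "polyhedral_cone \<sigma>" and "pointed \<sigma>"
    and "\<And>i. \<Delta> i = {} \<or> (rat_polyhedron (\<Delta> i) \<and> tailcone (\<Delta> i) = \<sigma>)"
    and "minkowski_sum \<Delta> \<subset> \<sigma>"
    and "lin_indep p q" and "line_torus p q \<noteq> {}"
  shows "(\<forall>u \<in> dual_cone \<sigma>.
            short_exact scale_C scale_C scale_L
              (ideal_tilde \<sigma> \<Delta> p q \<inter> degree_part_C u) (\<lambda>f. f)
              (A_C \<sigma> \<Delta> \<inter> degree_part_C u) (restr p q)
              (A_L \<sigma> \<Delta> p q \<inter> degree_part_L u))
         \<and> (\<forall>c. restr p q (Poly_Mapping.single 0 c) = Poly_Mapping.single 0 (const_fract c))
         \<and> closed_embedding_with_ideal (ring_on (A_C \<sigma> \<Delta>)) (ring_on (A_L \<sigma> \<Delta> p q))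
             (restr p q) (ideal_tilde \<sigma> \<Delta> p q)"
proof -
  interpret line_in_cone p q \<sigma> \<Delta>
    using assms by unfold_locales auto
  show ?thesis
    using short_exact_degree restr_const closed_embedding_restr by blast
qed

end
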